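(* Let $R$ be a complete discrete valuation ring with quotient field $K$ and maximal ideal $P=\pi R$, and let $\Lambda$ be a tiled $R$-order in $M_n(K)$ with exponent matrix $(\alpha_{ij})$ and link graph $Q(\Lambda)$. For $\sigma\in S_n$ consider the linear system $$x_i-x_j=\alpha_{ij}-\alpha_{\sigma(i)\sigma(j)},\qquad i<j. \qquad ( * )_\sigma$$ For ${\bf x}=(x_1,\dots,x_n)\in\mathbb{Z}^n$ put $d({\bf x})=\operatorname{diag}(\pi^{x_1},\dots,\pi^{x_n})$. (a) $\sigma\in\operatorname{Aut}(Q(\Lambda))$ is liftable if and only if the linear system $( * )_\sigma$ has a solution ${\bf x}=(x_1,\dots,x_n)$ in integers $x_i$. (b) If $\sigma$ is liftable, then $\iota_{d({\bf x})v(\sigma)}\in\operatorname{Aut}_R(\Lambda)$, where ${\bf x}$ is an integer solution of $( * )_\sigma$. (c) If $\varphi\in\operatorname{Aut}_R(\Lambda)$ is written as $\varphi=\iota_{udv(\sigma)}$ with $u\in\Lambda^*$, $d=\operatorname{diag}(\pi^{d_1},\dots,\pi^{d_n})$ ($d_i\in\mathbb{Z}$), and $\sigma\in S_n$, then ${\bf x}=(d_1,\dots,d_n)$ is a solution to $( * )_\sigma$. (d) Let $\mathcal{O}_\Lambda=\{\iota_{d({\bf x})v(\sigma)} : \sigma \text{ is liftable}\}$, where ${\bf x}$ denotes an integer solution of $( * )_\sigma$. Then $\mathcal{O}_\Lambda$ is a subgroup of $\operatorname{Aut}_R(\Lambda)$, and $\operatorname{Aut}_R(\Lambda)=\operatorn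ame{Inn}(\Lambda)\rtimes\mathcal{O}_\Lambda$.
   Context: Tiled orders: an $R$-order $\Lambda$ in $M_n(K)$ is tiled if it has a complete set of $n$ orthogonal idempotents $e_1,\dots,e_n$; without loss of generality $e_i$ is the standard diagonal matrix unit $e_{ii}$, and then $\Lambda=(P^{\alpha_{ij}})_n$, the set of matrices whose $(i,j)$ entry lies in $P^{\alpha_{ij}}=\pi^{\alpha_{ij}}R$ for all $i,j$, where the $\alpha_{ij}$ are non-negative integers with $\alpha_{ii}=0$ and $\alpha_{ij}+\alpha_{jk}\ge\alpha_{ik}$ for all $i,j,k$. The matrix $(\alpha_{ij})$ is the exponent matrix of $\Lambda$. The maximal two-sided ideals of $\Lambda$ are described as exactly $n$ distinct ideals $M_1,\dots,M_n$, where $M_k$ is obtained from $\Lambda$ by replacing the $R$ in position $(k,k)$ with $P$. Link graph: $Q(\Lambda)$ is the quiver with vertices $1,\dots,n$ and an arrow from $i$ to $j$ if and only if $M_jM_i\ne M_j\cap M_i$. Automorphisms of $Q(\Lambda)$ are identified with the permutations $\sigma\in S_n$ they induce on the vertices. Liftable: $\operatorname{Aut}_R(\Lambda)$ is the group of $R$-automorphisms of $\Lambda$, and $\operatorname{Inn}(\Lambda)$ is the subgroup of inner automorphisms (conjugations by units $u\in\Lambda^*$). Each $\varphi\in\operatorname{Aut}_R(\Lambda)$ permutes the maximal ideals, $\varphi(M_i)=M_{\sigma(i)}$, and $\varphi\mapsto\sigma$ gives a group homomorphism $\Phi:\operatorname{Aut}_R(\Lambda)\to\operatorname{Aut}(Q(\Lambda))$.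 An element of $\operatorname{Aut}(Q(\Lambda))$ is liftable if it is in the image of $\Phi$. Notation: for $x\in GL_n(K)$, $\iota_x$ denotes conjugation by $x$, $y\mapsto x^{-1}yx$. For $\sigma\in S_n$, $v(\sigma)\in M_n(K)$ is the permutation matrix with $v(\sigma)_{ij}=1$ if $j=\sigma(i)$ and $0$ otherwise. Every $\varphi\in\operatorname{Aut}_R(\Lambda)$ can be written in the form $\iota_{udv(\sigma)}$ used in (c).
   Formalization: In (a) the system is taken over all ordered pairs (i,j), not only i<j, since with i<j alone the "if" direction is false (e.g. n=3, exponent matrix with rows (0,1,2),(2,0,3),(2,1,0), σ=(2 3)); (c) likewise concludes all the equations. *)

theory Defs
  imports
    "HOL-Analysis.Cartesian_Space"
    "HOL-Algebra.Bij"
    "HOL-Algebra.Coset"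
    "HOL-Algebra.Ideal_Product"
    "HOL-Algebra.Ring_Divisibility"
    "HOL-Combinatorics.Permutations"
begin

section \<open>Complete discrete valuation rings inside their quotient field\<close>

text \<open>The field \<open>K\<close> is the type \<open>'k\<close>, and \<open>R\<close> is a subset of it.\<close>

definition subring_record :: "'k::field set \<Rightarrow> 'k ring" where
  "subring_record R = \<lparr>carrier = R, monoid.mult = (*), one = 1, zero = 0, add = (+)\<rparr>"

definition discrete_valuation_ring :: "('a, 'b) ring_scheme \<Rightarrow> bool" where
  "discrete_valuation_ring A \<longleftrightarrow>
     principal_domain A \<and> \<not> field A \<and> (\<exists>!I. maximalideal I A)"

definition quotient_field_of :: "'k::field set \<Rightarrow> bool" where
  "quotient_field_of R \<longleftrightarrow> (\<forall>x. \<exists>a\<in>R. \<exists>b\<in>R. b \<noteq> 0 \<and> x = a / b)"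

definition P_power :: "'k::field set \<Rightarrow> 'k \<Rightarrow> nat \<Rightarrow> 'k set" where
  "P_power R \<pi> m = PIdl\<^bsub>subring_record R\<^esub> (\<pi> ^ m)"

text \<open>Completeness in the \<open>P\<close>-adic topology; limits are unique because a discrete valuation
  ring is \<open>P\<close>-adically separated.\<close>

definition adically_complete :: "'k::field set \<Rightarrow> 'k \<Rightarrow> bool" where
  "adically_complete R \<pi> \<longleftrightarrow>
     (\<forall>s :: nat \<Rightarrow> 'k.
        (\<forall>i. s i \<in> R) \<and> (\<forall>m. \<exists>N. \<forall>i\<ge>N. \<forall>j\<ge>N. s i - s j \<in> P_power R \<pi> m) \<longrightarrow>
        (\<exists>l\<in>R. \<forall>m. \<exists>N. \<forall>i\<ge>N. s i - l \<in> P_power R \<pi> m))"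

definition complete_dvr :: "'k::field set \<Rightarrow> 'k \<Rightarrow> bool" where
  "complete_dvr R \<pi> \<longleftrightarrow>
     discrete_valuation_ring (subring_record R) \<and>
     quotient_field_of R \<and>
     \<pi> \<in> R \<and> maximalideal (P_power R \<pi> 1) (subring_record R) \<and>
     adically_complete R \<pi>"


section \<open>Tiled orders and their link graphs\<close>

definition exponent_matrix :: "('n \<Rightarrow> 'n \<Rightarrow> nat) \<Rightarrow> bool" where
  "exponent_matrix \<alpha> \<longleftrightarrow>
     (\<forall>i. \<alpha> i i = 0) \<and> (\<forall>i j k. \<alpha> i j + \<alpha> j k \<ge> \<alpha> i k)"

definition tiled_order ::
    "'k::field set \<Rightarrow> 'k \<Rightarrow> ('n::finite \<Rightarrow> 'n \<Rightarrow> nat) \<Rightarrow> ('k^'n^'n) set" where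
  "tiled_order R \<pi> \<alpha> = {A. \<forall>i j. A $ i $ j \<in> P_power R \<pi> (\<alpha> i j)}"

definition tiled_ring ::
    "'k::field set \<Rightarrow> 'k \<Rightarrow> ('n::finite \<Rightarrow> 'n \<Rightarrow> nat) \<Rightarrow> ('k^'n^'n) ring" where
  "tiled_ring R \<pi> \<alpha> =
     \<lparr>carrier = tiled_order R \<pi> \<alpha>, monoid.mult = (**), one = mat 1, zero = 0, add = (+)\<rparr>"

definition max_ideal ::
    "'k::field set \<Rightarrow> 'k \<Rightarrow> ('n::finite \<Rightarrow> 'n \<Rightarrow> nat) \<Rightarrow> 'n \<Rightarrow> ('k^'n^'n) set" where
  "max_ideal R \<pi> \<alpha> k = {A \<in> tiled_order R \<pi> \<alpha>. A $ k $ k \<in> P_power R \<pi> 1}"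

text \<open>The standing convention that the maximal two-sided ideals are exactly the \<open>n\<close> distinct
  ideals \<open>max_ideal R \<pi> \<alpha> k\<close>. It excludes \<open>\<alpha> i j + \<alpha> j i = 0\<close> with \<open>i \<noteq> j\<close>
  (for instance the full matrix ring over \<open>R\<close> when \<open>n \<ge> 2\<close>), where these sets are not all
  ideals. In HOL-Algebra, \<open>ideal\<close> and \<open>maximalideal\<close> are two-sided.\<close>

definition standard_max_ideals ::
    "'k::field set \<Rightarrow> 'k \<Rightarrow> ('n::finite \<Rightarrow> 'n \<Rightarrow> nat) \<Rightarrow> bool" where
  "standard_max_ideals R \<pi> \<alpha> \<longleftrightarrow>
     bij_betw (max_ideal R \<pi> \<alpha>) UNIV {I. maximalideal I (tiled_ring R \<pi> \<alpha>)}"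

definition link_graph ::
    "'k::field set \<Rightarrow> 'k \<Rightarrow> ('n::finite \<Rightarrow> 'n \<Rightarrow> nat) \<Rightarrow> ('n \<times> 'n) set" where
  "link_graph R \<pi> \<alpha> =
     {(i, j). ideal_prod (tiled_ring R \<pi> \<alpha>) (max_ideal R \<pi> \<alpha> j) (max_ideal R \<pi> \<alpha> i)
              \<noteq> max_ideal R \<pi> \<alpha> j \<inter> max_ideal R \<pi> \<alpha> i}"

definition graph_automorphisms :: "('n \<times> 'n) set \<Rightarrow> ('n \<Rightarrow> 'n) set" where
  "graph_automorphisms E =
     {\<sigma>. \<sigma> permutes UNIV \<and> (\<forall>i j. (i, j) \<in> E \<longleftrightarrow> (\<sigma> i, \<sigma> j) \<in> E)}"


section \<open>Automorphisms\<close>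

text \<open>Automorphisms are extensional functions on the order, composed as in \<open>BijGroup\<close>.
  A scalar \<open>r\<close> acts as the scalar matrix \<open>mat r\<close>.\<close>

definition AutR ::
    "'k::field set \<Rightarrow> 'k \<Rightarrow> ('n::finite \<Rightarrow> 'n \<Rightarrow> nat) \<Rightarrow> ('k^'n^'n \<Rightarrow> 'k^'n^'n) monoid" where
  "AutR R \<pi> \<alpha> = (BijGroup (tiled_order R \<pi> \<alpha>))
     \<lparr>carrier := {\<phi> \<in> Bij (tiled_order R \<pi> \<alpha>).
                   \<phi> \<in> ring_hom (tiled_ring R \<pi> \<alpha>) (tiled_ring R \<pi> \<alpha>) \<and>
                   (\<forall>r\<in>R. \<forall>A\<in>tiled_order R \<pi> \<alpha>. \<phi> (mat r ** A) = mat r ** \<phi> A)}\<rparr>"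

definition conj_by ::
    "('k::field^'n::finite^'n) set \<Rightarrow> 'k^'n^'n \<Rightarrow> ('k^'n^'n \<Rightarrow> 'k^'n^'n)" where
  "conj_by S x = (\<lambda>y\<in>S. matrix_inv x ** y ** x)"

definition Inn ::
    "'k::field set \<Rightarrow> 'k \<Rightarrow> ('n::finite \<Rightarrow> 'n \<Rightarrow> nat) \<Rightarrow> ('k^'n^'n \<Rightarrow> 'k^'n^'n) set" where
  "Inn R \<pi> \<alpha> = conj_by (tiled_order R \<pi> \<alpha>) ` Units (tiled_ring R \<pi> \<alpha>)"

definition Phi ::
    "'k::field set \<Rightarrow> 'k \<Rightarrow> ('n::finite \<Rightarrow> 'n \<Rightarrow> nat) \<Rightarrow> ('k^'n^'n \<Rightarrow> 'k^'n^'n) \<Rightarrow> ('n \<Rightarrow> 'n)" where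
  "Phi R \<pi> \<alpha> \<phi> =
     (THE \<sigma>. \<sigma> permutes UNIV \<and> (\<forall>i. \<phi> ` max_ideal R \<pi> \<alpha> i = max_ideal R \<pi> \<alpha> (\<sigma> i)))"

definition liftable ::
    "'k::field set \<Rightarrow> 'k \<Rightarrow> ('n::finite \<Rightarrow> 'n \<Rightarrow> nat) \<Rightarrow> ('n \<Rightarrow> 'n) \<Rightarrow> bool" where
  "liftable R \<pi> \<alpha> \<sigma> \<longleftrightarrow>
     \<sigma> \<in> graph_automorphisms (link_graph R \<pi> \<alpha>) \<and>
     \<sigma> \<in> Phi R \<pi> \<alpha> ` carrier (AutR R \<pi> \<alpha>)"

definition diag_pow :: "'k::field \<Rightarrow> ('n::finite \<Rightarrow> int) \<Rightarrow> 'k^'n^'n" where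
  "diag_pow \<pi> x = (\<chi> i j. if i = j then \<pi> powi x i else 0)"

definition perm_matrix :: "('n::finite \<Rightarrow> 'n) \<Rightarrow> 'k::field^'n^'n" where
  "perm_matrix \<sigma> = (\<chi> i j. if j = \<sigma> i then 1 else 0)"


section \<open>The linear system\<close>

definition solves_system ::
    "('n::linorder \<Rightarrow> 'n \<Rightarrow> nat) \<Rightarrow> ('n \<Rightarrow> 'n) \<Rightarrow> ('n \<Rightarrow> int) \<Rightarrow> bool" where
  "solves_system \<alpha> \<sigma> x \<longleftrightarrow>
     (\<forall>i j. i < j \<longrightarrow> x i - x j = int (\<alpha> i j) - int (\<alpha> (\<sigma> i) (\<sigma> j)))"

text \<open>The equations for \<open>i > j\<close> do not follow from those for \<open>i < j\<close>, and without them
  solvability does not imply liftability. For \<open>n = 3\<close> let \<open>\<alpha>\<close> have the rows \<open>(0, 1, 2)\<close>,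
  \<open>(2, 0, 3)\<close>, \<open>(2, 1, 0)\<close> and let \<open>\<sigma>\<close> be the transposition of 2 and 3. All triangle
  inequalities with distinct indices are strict and all sums \<open>\<alpha> i j + \<alpha> j i\<close> with \<open>i \<noteq> j\<close>
  are at least 3, so the link graph has every possible arrow and \<open>\<sigma>\<close> is an automorphism of it.
  The equations for \<open>i < j\<close> have the solution \<open>x = (0, 1, -1)\<close>, but \<open>\<sigma>\<close> is not liftable:
  \<open>\<alpha> 1 2 + \<alpha> 2 1 = 3\<close> whereas \<open>\<alpha> 1 3 + \<alpha> 3 1 = 4\<close>. If \<open>\<sigma>\<close> is liftable, both systems
  have the same solutions.\<close>

definition solves_full_system ::
    "('n \<Rightarrow> 'n \<Rightarrow> nat) \<Rightarrow> ('n \<Rightarrow> 'n) \<Rightarrow> ('n \<Rightarrow> int) \<Rightarrow> bool" where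
  "solves_full_system \<alpha> \<sigma> x \<longleftrightarrow>
     (\<forall>i j. x i - x j = int (\<alpha> i j) - int (\<alpha> (\<sigma> i) (\<sigma> j)))"

definition O_Lambda ::
    "'k::field set \<Rightarrow> 'k \<Rightarrow> ('n::{finite,linorder} \<Rightarrow> 'n \<Rightarrow> nat) \<Rightarrow>
     ('k^'n::{finite,linorder}^'n::{finite,linorder} \<Rightarrow> 'k^'n::{finite,linorder}^'n::{finite,linorder}) set" where
  "O_Lambda R \<pi> \<alpha> =
     {conj_by (tiled_order R \<pi> \<alpha>) (diag_pow \<pi> x ** perm_matrix \<sigma>) | x \<sigma>.
        liftable R \<pi> \<alpha> \<sigma> \<and> solves_system \<alpha> \<sigma> x}"

definition internal_semidirect :: "('a, 'b) monoid_scheme \<Rightarrow> 'a set \<Rightarrow> 'a set \<Rightarrow> bool" where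
  "internal_semidirect G N H \<longleftrightarrow>
     normal N G \<and> subgroup H G \<and> N \<inter> H = {\<one>\<^bsub>G\<^esub>} \<and> N <#>\<^bsub>G\<^esub> H = carrier G"

end

theory Submission
  imports Defs
begin

text \<open>
  An \<open>R\<close>-automorphism \<open>\<phi>\<close> of the order permutes the maximal ideals, say by \<open>\<sigma>\<close>. Let \<open>f i\<close> be the
  image of the \<open>i\<close>-th diagonal matrix unit and \<open>e i\<close> the diagonal matrix unit at \<open>\<sigma> i\<close>; the entry
  of \<open>f i\<close> at \<open>(\<sigma> i, \<sigma> i)\<close> is a unit of \<open>R\<close>. Put \<open>w = (\<Sum>i. f i ** e i)\<close> and
  \<open>w' = (\<Sum>i. e i ** f i)\<close>. The \<open>f i\<close> are orthogonal, so \<open>w' ** w\<close> is a diagonal matrix of units;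
  hence \<open>w\<close> is a unit of the order, and conjugation by \<open>w\<close> moves \<open>f i\<close> to \<open>e i\<close>.

  After this correction \<open>\<phi>\<close> maps the \<open>(i, j)\<close> corner of the order onto the \<open>(\<sigma> i, \<sigma> j)\<close> corner,
  multiplying entries by a scalar \<open>b i j\<close>. Multiplicativity gives \<open>b i j * b j k = b i k\<close>, so
  \<open>b i j = t j / t i\<close> and \<open>\<phi>\<close> is conjugation by a monomial matrix. Writing
  \<open>t i = \<eta> i * \<pi> powi x i\<close> with \<open>\<eta> i\<close> a unit, the order is preserved exactly when \<open>x\<close> solves the
  linear system, and the \<open>\<eta> i\<close> are absorbed into an inner automorphism. Inner automorphisms fix
  every maximal ideal, which yields the trivial intersection.
\<close>

section \<open>Discrete valuation rings\<close>

lemma subring_record_simps [simp]: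
  "carrier (subring_record R) = R"
  "monoid.mult (subring_record R) = (*)"
  "one (subring_record R) = 1"
  "zero (subring_record R) = 0"
  "add (subring_record R) = (+)"
  by (simp_all add: subring_record_def)

locale dvr_in_field =
  fixes R :: "'k::field set" and \<pi> :: 'k
  assumes dvr: "discrete_valuation_ring (subring_record R)"
    and quotient_field: "quotient_field_of R"
    and uniformizer_in: "\<pi> \<in> R"
    and uniformizer_maximal: "maximalideal (P_power R \<pi> 1) (subring_record R)"
begin

text \<open>Inverses are taken in the field \<open>'k\<close>, so that membership is a computation
  with field elements; \<open>Units_eq_unit_group\<close> identifies the set with the abstract unit
  group.\<close>

definition unit_group :: "'k set" where
  "unit_group = {u \<in> R. u \<noteq> 0 \<and> inverse u \<in> R}"

text \<open>The rewrites state all facts on principal ideal domains in the operations of the field,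
  so that they combine with field arithmetic.\<close>

sublocale valuation_ring: principal_domain "subring_record R"
  rewrites "carrier (subring_record R) = R"
    and "monoid.mult (subring_record R) = (*)"
    and "one (subring_record R) = 1"
    and "zero (subring_record R) = 0"
    and "add (subring_record R) = (+)"
  using dvr by (auto simp: discrete_valuation_ring_def subring_record_def)

lemma sum_closed: "(\<And>i. i \<in> I \<Longrightarrow> f i \<in> R) \<Longrightarrow> sum f I \<in> R"
  by (induction I rule: infinite_finite_induct) auto

lemma power_closed: "a \<in> R \<Longrightarrow> a ^ m \<in> R"
  by (induction m) auto

lemma Units_eq_unit_group: "Units (subring_record R) = unit_group"
proof -
  have "inverse a = b" if "b * a = 1" for a b :: 'k
    using that by (metis inverse_unique mult.commute)
  then show ?thesis
    unfolding Units_def unit_group_def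
    by (auto simp: subring_record_def intro!: bexI[of _ "inverse _"])
qed

lemma P_power_eq: "P_power R \<pi> m = {r * \<pi> ^ m | r. r \<in> R}"
  by (simp add: P_power_def cgenideal_def subring_record_def)

text \<open>Otherwise the zero ideal would be maximal and \<open>R\<close> a field.\<close>

lemma uniformizer_nonzero: "\<pi> \<noteq> 0"
proof
  assume "\<pi> = 0"
  then have "P_power R \<pi> 1 = {0}"
    unfolding P_power_eq by auto
  then have "maximalideal {0} (subring_record R)"
    using uniformizer_maximal by simp
  then have "field (subring_record R)"
    using valuation_ring.zeromaximalideal_eq_field by simp
  then show False
    using dvr by (simp add: discrete_valuation_ring_def)
qed

text \<open>Otherwise \<open>P\<close> would be all of \<open>R\<close>, whereas a maximal ideal is
  proper.\<close>

lemma inverse_uniformizer_notin: "inverse \<pi> \<notin> R"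
proof
  assume *: "inverse \<pi> \<in> R"
  have "x \<in> P_power R \<pi> 1" if "x \<in> R" for x
    using that * uniformizer_nonzero
    by (auto simp: P_power_eq intro!: exI[of _ "x * inverse \<pi>"])
  moreover have "P_power R \<pi> 1 \<subseteq> R"
    using uniformizer_in by (auto simp: P_power_eq)
  ultimately show False
    using maximalideal.I_notcarr[OF uniformizer_maximal]
    by (auto simp: subring_record_def)
qed

text \<open>In a principal ideal domain an irreducible element generates a maximal ideal. There is
  only one, so \<open>f\<close> and \<open>\<pi>\<close> generate the same ideal and are
  associated.\<close>

lemma irreducible_eq_unit_times_uniformizer:
  assumes "f \<in> R" "ring_irreducible\<^bsub>subring_record R\<^esub> f"
  obtains u where "u \<in> unit_group" "f = u * \<pi>"
proof -
  have "maximalideal (PIdl\<^bsub>subring_record R\<^esub> f) (subring_record R)"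
    using valuation_ring.irreducible_imp_maximalideal assms by simp
  then have "PIdl\<^bsub>subring_record R\<^esub> f = P_power R \<pi> 1"
    using dvr uniformizer_maximal by (auto simp: discrete_valuation_ring_def)
  then have "f \<sim>\<^bsub>subring_record R\<^esub> \<pi>"
    using valuation_ring.associated_iff_same_ideal[of f \<pi>] assms uniformizer_in
    by (simp add: P_power_def)
  then show thesis
    using valuation_ring.ring_associated_iff[of f \<pi>] assms uniformizer_in that
    by (auto simp: Units_eq_unit_group)
qed

lemma one_in_unit_group: "1 \<in> unit_group"
  by (simp add: unit_group_def)

lemma unit_group_mult: "u \<in> unit_group \<Longrightarrow> v \<in> unit_group \<Longrightarrow> u * v \<in> unit_group"
  by (auto simp: unit_group_def)

lemma unit_group_inverse: "u \<in> unit_group \<Longrightarrow> inverse u \<in> unit_group"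
  by (auto simp: unit_group_def)

text \<open>A nonzero nonunit is a product of irreducibles, each a unit times \<open>\<pi>\<close>;
  the exponent is the number of factors.\<close>

lemma exists_uniformizer_power_nat:
  assumes "a \<in> R" "a \<noteq> 0"
  obtains u m where "u \<in> unit_group" "a = u * \<pi> ^ m"
proof (cases "a \<in> unit_group")
  case True
  then show ?thesis using that[of a 0] by simp
next
  case False
  obtain fs where fs: "set fs \<subseteq> R - {0}" "wfactors (mult_of (subring_record R)) fs a"
    using valuation_ring.factorization_property[of a] assms False
    by (auto simp: Units_eq_unit_group)
  have "\<exists>u\<in>unit_group. f = u * \<pi>" if "f \<in> set fs" for f
  proof -
    have "irreducible (mult_of (subring_record R)) f" "f \<in> R - {0}"
      using fs that by (auto simp: wfactors_def)
    then show ?thesis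
      using irreducible_eq_unit_times_uniformizer valuation_ring.ring_irreducibleI'
      by (metis DiffD1)
  qed
  then have "\<exists>u\<in>unit_group. foldr (*) fs 1 = u * \<pi> ^ length fs"
  proof (induction fs)
    case Nil
    then show ?case using one_in_unit_group by auto
  next
    case (Cons f fs)
    then obtain u v where "u \<in> unit_group" "f = u * \<pi>"
      "v \<in> unit_group" "foldr (*) fs 1 = v * \<pi> ^ length fs"
      by (metis list.set_intros)
    then show ?case
      by (auto intro!: bexI[of _ "u * v"] unit_group_mult)
  qed
  then obtain u where u: "u \<in> unit_group" "foldr (*) fs 1 = u * \<pi> ^ length fs"
    by blast
  have "foldr (*) fs 1 \<sim>\<^bsub>mult_of (subring_record R)\<^esub> a"
    using fs by (simp add: wfactors_def)
  moreover have "foldr (*) fs 1 \<in> R - {0}"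
    using u uniformizer_nonzero uniformizer_in
    by (auto simp: unit_group_def intro!: power_closed)
  \<comment> \<open>The factorization lives in the monoid of nonzero elements; association is
    carried over to the ring and then reversed, to express \<open>a\<close> by the product.\<close>
  ultimately have "foldr (*) fs 1 \<sim>\<^bsub>subring_record R\<^esub> a"
    using valuation_ring.assoc_iff_assoc_mult[of "foldr (*) fs 1" a] assms by blast
  then have "a \<sim>\<^bsub>subring_record R\<^esub> foldr (*) fs 1"
    by (simp only: associated_def conj_commute)
  then obtain v where "v \<in> unit_group" "a = v * foldr (*) fs 1"
    using valuation_ring.ring_associated_iff[of a "foldr (*) fs 1"] assms \<open>foldr (*) fs 1 \<in> R - {0}\<close>
    by (auto simp: Units_eq_unit_group)
  then show ?thesis
    using that[of "v * u" "length fs"] u unit_group_mult by simp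
qed

lemma exists_uniformizer_power:
  assumes "a \<noteq> 0"
  obtains u m where "u \<in> unit_group" "a = u * \<pi> powi m"
proof -
  obtain b c where "b \<in> R" "c \<in> R" "c \<noteq> 0" "a = b / c"
    using quotient_field unfolding quotient_field_of_def by blast
  moreover from this assms have "b \<noteq> 0"
    by auto
  ultimately obtain u m v k where "u \<in> unit_group" "b = u * \<pi> ^ m"
    "v \<in> unit_group" "c = v * \<pi> ^ k"
    using exists_uniformizer_power_nat by metis
  moreover from this have "a = (u * inverse v) * \<pi> powi (int m - int k)"
    using \<open>a = b / c\<close> uniformizer_nonzero by (simp add: power_int_diff field_simps)
  ultimately show thesis
    using that unit_group_mult unit_group_inverse by blast
qed

lemma uniformizer_powi_in_iff: "\<pi> powi m \<in> R \<longleftrightarrow> m \<ge> 0"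
proof
  assume *: "\<pi> powi m \<in> R"
  show "m \<ge> 0"
  proof (rule ccontr)
    assume "\<not> m \<ge> 0"
    \<comment> \<open>For negative \<open>m\<close> the exponent \<open>- m - 1\<close> is
      non-negative, so the second factor lies in \<open>R\<close>.\<close>
    then have "inverse \<pi> = \<pi> powi m * \<pi> ^ nat (- m - 1)"
      using uniformizer_nonzero
      by (simp flip: power_int_of_nat power_int_add add: power_int_minus)
    then show False
      using * inverse_uniformizer_notin uniformizer_in
      by (metis power_closed valuation_ring.m_closed)
  qed
next
  assume "m \<ge> 0"
  then show "\<pi> powi m \<in> R"
    using uniformizer_in by (simp add: power_int_def power_closed)
qed

lemma uniformizer_powi_in_unit_group_iff: "\<pi> powi m \<in> unit_group \<longleftrightarrow> m = 0"
  using uniformizer_powi_in_iff[of m] uniformizer_powi_in_iff[of "- m"] uniformizer_nonzero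
  by (auto simp: unit_group_def power_int_minus)

lemma in_P_power_iff: "x \<in> P_power R \<pi> m \<longleftrightarrow> x / \<pi> ^ m \<in> R"
  using uniformizer_nonzero by (force simp: P_power_eq)

text \<open>\<open>R\<close> is local with maximal ideal \<open>P\<close>: a unit in
  \<open>P\<close> would put the inverse of \<open>\<pi>\<close> into \<open>R\<close>, and a
  nonzero nonunit has a positive power of \<open>\<pi>\<close> as a factor.\<close>

lemma unit_iff_notin_P_power_1:
  assumes "a \<in> R"
  shows "a \<in> unit_group \<longleftrightarrow> a \<notin> P_power R \<pi> 1"
proof
  assume *: "a \<in> unit_group"
  show "a \<notin> P_power R \<pi> 1"
  proof
    assume "a \<in> P_power R \<pi> 1"
    then have "a / \<pi> \<in> R" by (simp add: in_P_power_iff)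
    then have "inverse a * (a / \<pi>) \<in> R"
      using * by (simp add: unit_group_def del: times_divide_eq_right)
    then show False
      using * inverse_uniformizer_notin by (simp add: unit_group_def inverse_eq_divide)
  qed
next
  assume *: "a \<notin> P_power R \<pi> 1"
  then have "a \<noteq> 0" by (auto simp: in_P_power_iff)
  then obtain u m where u: "u \<in> unit_group" "a = u * \<pi> ^ m"
    using assms exists_uniformizer_power_nat by blast
  show "a \<in> unit_group"
  proof (cases m)
    case 0
    then show ?thesis using u by simp
  next
    case (Suc k)
    then have "a / \<pi> = u * \<pi> ^ k"
      using u uniformizer_nonzero by simp
    then show ?thesis
      using * u uniformizer_in by (auto simp: in_P_power_iff unit_group_def power_closed)
  qed
qed

end

section \<open>Monomial matrices\<close>

definition matrix_unit :: "'n \<Rightarrow> 'n \<Rightarrow> 'k \<Rightarrow> 'k::zero^'n::finite^'n" where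
  "matrix_unit i j c = (\<chi> r s. if r = i \<and> s = j then c else 0)"

lemma matrix_unit_nth: "matrix_unit i j c $ r $ s = (if r = i \<and> s = j then c else 0)"
  by (simp add: matrix_unit_def)

lemma matrix_unit_mult_left_nth:
  "(matrix_unit i j c ** A) $ r $ s = (if r = i then c * A $ j $ s else 0)"
  for A :: "'k::semiring_1^'n::finite^'n"
  by (auto simp: matrix_matrix_mult_def matrix_unit_def
      if_distrib[of "\<lambda>x. x * _"] if_distrib[of "(*) _"] cong: if_cong)

lemma matrix_unit_mult_right_nth:
  "(A ** matrix_unit i j c) $ r $ s = (if s = j then A $ r $ i * c else 0)"
  for A :: "'k::semiring_1^'n::finite^'n"
  by (auto simp: matrix_matrix_mult_def matrix_unit_def
      if_distrib[of "\<lambda>x. x * _"] if_distrib[of "(*) _"] cong: if_cong)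

lemma matrix_unit_mult:
  "matrix_unit i j c ** matrix_unit k l d =
    (if j = k then matrix_unit i l (c * d) else (0 :: 'k::semiring_1^'n::finite^'n))"
  by (simp add: vec_eq_iff matrix_unit_mult_left_nth matrix_unit_nth)

lemma matrix_unit_sandwich:
  "matrix_unit i i 1 ** A ** matrix_unit j j 1 = matrix_unit i j (A $ i $ j)"
  for A :: "'k::semiring_1^'n::finite^'n"
  by (simp add: vec_eq_iff matrix_unit_mult_left_nth matrix_unit_mult_right_nth matrix_unit_nth)

lemma mat_mult_nth: "(mat r ** A) $ i $ j = r * A $ i $ j"
  for A :: "'k::semiring_1^'n::finite^'n"
  by (auto simp: matrix_matrix_mult_def mat_def
      if_distrib[of "\<lambda>x. x * _"] if_distrib[of "(*) _"] cong: if_cong)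

lemma mat_mult_commute: "mat r ** A = A ** mat r"
  for A :: "'k::comm_semiring_1^'n::finite^'n"
  by (auto simp: matrix_matrix_mult_def vec_eq_iff mat_def mult.commute
      if_distrib[of "\<lambda>x. x * _"] if_distrib[of "(*) _"] cong: if_cong)

lemma matrix_add_rdistrib: "(A + B) ** C = A ** C + B ** C"
  for A B :: "'k::semiring_1^'n::finite^'m"
  by (simp add: vec_eq_iff matrix_matrix_mult_def sum.distrib distrib_right)

section \<open>Monomial matrices and their inverses\<close>

definition monomial_matrix :: "('n \<Rightarrow> 'k) \<Rightarrow> ('n \<Rightarrow> 'n) \<Rightarrow> 'k::zero^'n::finite^'n" where
  "monomial_matrix t \<sigma> = (\<chi> i j. if j = \<sigma> i then t i else 0)"

text \<open>The explicit inverse of \<open>monomial_matrix t \<sigma>\<close>, written without the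
  inverse permutation.\<close>

definition monomial_inverse :: "('n \<Rightarrow> 'k) \<Rightarrow> ('n \<Rightarrow> 'n) \<Rightarrow> 'k::field^'n::finite^'n" where
  "monomial_inverse t \<sigma> = (\<chi> i j. if i = \<sigma> j then inverse (t j) else 0)"

lemma diag_pow_mult_perm_matrix:
  "diag_pow \<pi> x ** perm_matrix \<sigma> = monomial_matrix (\<lambda>i. \<pi> powi x i) \<sigma>"
  by (auto simp: matrix_matrix_mult_def vec_eq_iff diag_pow_def perm_matrix_def monomial_matrix_def
      if_distrib[of "\<lambda>x. x * _"] cong: if_cong)

lemma monomial_matrix_mult_nth:
  "(monomial_matrix t \<sigma> ** A) $ i $ j = t i * A $ \<sigma> i $ j"
  for A :: "'k::semiring_1^'n::finite^'n"
  by (auto simp: matrix_matrix_mult_def monomial_matrix_def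
      if_distrib[of "\<lambda>x. x * _"] if_distrib[of "(*) _"] cong: if_cong)

lemma monomial_matrix_mult:
  "monomial_matrix s \<sigma> ** monomial_matrix t \<tau> = monomial_matrix (\<lambda>i. s i * t (\<sigma> i)) (\<tau> \<circ> \<sigma>)"
  for s t :: "'n::finite \<Rightarrow> 'k::semiring_1"
  by (simp add: vec_eq_iff monomial_matrix_mult_nth) (simp add: monomial_matrix_def)

lemma monomial_matrix_id: "monomial_matrix (\<lambda>_. 1) id = (mat 1 :: 'k::zero_neq_one^'n::finite^'n)"
  by (auto simp: monomial_matrix_def mat_def vec_eq_iff)

lemma mult_monomial_inverse_nth:
  "(A ** monomial_inverse t \<sigma>) $ i $ j = A $ i $ \<sigma> j * inverse (t j)"
  for A :: "'k::field^'n::finite^'n"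
  by (auto simp: matrix_matrix_mult_def monomial_inverse_def
      if_distrib[of "\<lambda>x. x * _"] if_distrib[of "(*) _"] cong: if_cong)

text \<open>Reading the product in column \<open>\<sigma> j\<close> keeps the inverse of
  \<open>\<sigma>\<close> out of the formula.\<close>

lemma mult_monomial_matrix_nth:
  fixes A :: "'k::semiring_1^'n::finite^'n"
  assumes "inj \<sigma>"
  shows "(A ** monomial_matrix t \<sigma>) $ i $ \<sigma> j = A $ i $ j * t j"
  using assms
  by (auto simp: matrix_matrix_mult_def inj_eq monomial_matrix_def
      if_distrib[of "\<lambda>x. x * _"] if_distrib[of "(*) _"] cong: if_cong)

lemma monomial_inverse_mult_nth:
  fixes A :: "'k::field^'n::finite^'n"
  assumes "inj \<sigma>"
  shows "(monomial_inverse t \<sigma> ** A) $ \<sigma> i $ j = inverse (t i) * A $ i $ j"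
  using assms
  by (auto simp: matrix_matrix_mult_def inj_eq monomial_inverse_def
      if_distrib[of "\<lambda>x. x * _"] if_distrib[of "(*) _"] cong: if_cong)

lemma monomial_matrix_mult_inverse:
  assumes "\<sigma> permutes UNIV" "\<And>i. t i \<noteq> 0"
  shows "monomial_matrix t \<sigma> ** monomial_inverse t \<sigma> = mat 1"
    and "monomial_inverse t \<sigma> ** monomial_matrix t \<sigma> = mat 1"
proof -
  have "monomial_inverse t \<sigma> $ \<sigma> i $ j = (if i = j then inverse (t j) else 0)" for i j
    using permutes_inj[OF assms(1)] by (auto simp: monomial_inverse_def dest: injD)
  then show "monomial_matrix t \<sigma> ** monomial_inverse t \<sigma> = mat 1"
    using assms by (simp add: vec_eq_iff monomial_matrix_mult_nth mat_def)
  then show "monomial_inverse t \<sigma> ** monomial_matrix t \<sigma> = mat 1"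
    by (simp add: matrix_left_right_inverse)
qed

text \<open>\<open>matrix_inv\<close> is a choice among two-sided inverses; for square matrices over
  a field a left inverse is two-sided, and it is unique.\<close>

lemma matrix_inv_eqI:
  fixes X :: "'k::field^'n::finite^'n"
  assumes "Y ** X = mat 1"
  shows "matrix_inv X = Y"
proof -
  have "X ** Y = mat 1"
    using assms by (simp add: matrix_left_right_inverse)
  then have "X ** matrix_inv X = mat 1 \<and> matrix_inv X ** X = mat 1"
    unfolding matrix_inv_def using assms by (rule_tac someI[of _ Y]) simp
  then show ?thesis
    by (metis \<open>Y ** X = mat 1\<close> matrix_mul_assoc matrix_mul_lid matrix_mul_rid)
qed

lemma conj_by_apply:
  assumes "Y ** X = mat 1" "A \<in> S"
  shows "conj_by S X A = Y ** A ** X"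
  using assms by (simp add: conj_by_def matrix_inv_eqI)

lemma conj_by_extensional: "conj_by S X \<in> extensional S"
  by (simp add: conj_by_def)

text \<open>Conjugation moves position \<open>(i, j)\<close> to
  \<open>(\<sigma> i, \<sigma> j)\<close> and rescales it. These positions exhaust the matrix, so
  the formula determines the whole image.\<close>

lemma conj_by_monomial_nth:
  assumes "\<sigma> permutes UNIV" "\<And>i. t i \<noteq> 0" "A \<in> S"
  shows "conj_by S (monomial_matrix t \<sigma>) A $ \<sigma> i $ \<sigma> j = A $ i $ j * (t j / t i)"
  using permutes_inj[OF assms(1)] assms
  by (simp add: conj_by_apply[OF monomial_matrix_mult_inverse(2)] mult_monomial_matrix_nth
      monomial_inverse_mult_nth field_simps)

section \<open>The ring of a tiled order and its automorphisms\<close>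

lemma tiled_ring_simps [simp]:
  "carrier (tiled_ring R \<pi> \<alpha>) = tiled_order R \<pi> \<alpha>"
  "monoid.mult (tiled_ring R \<pi> \<alpha>) = (**)"
  "one (tiled_ring R \<pi> \<alpha>) = mat 1"
  "zero (tiled_ring R \<pi> \<alpha>) = 0"
  "add (tiled_ring R \<pi> \<alpha>) = (+)"
  by (simp_all add: tiled_ring_def)

locale standard_tiled_order = dvr_in_field R \<pi>
  for R :: "'k::field set" and \<pi> :: 'k +
  fixes \<alpha> :: "'n::finite \<Rightarrow> 'n \<Rightarrow> nat"
  assumes exponents: "exponent_matrix \<alpha>"
    and standard: "standard_max_ideals R \<pi> \<alpha>"
begin

abbreviation \<Lambda> :: "('k^'n^'n) set" where
  "\<Lambda> \<equiv> tiled_order R \<pi> \<alpha>"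

abbreviation Aut where
  "Aut \<equiv> AutR R \<pi> \<alpha>"

section \<open>Closure properties of the order\<close>

lemma exponent_diag [simp]: "\<alpha> i i = 0"
  and exponent_triangle: "\<alpha> i k \<le> \<alpha> i j + \<alpha> j k"
  using exponents by (auto simp: exponent_matrix_def)

lemma order_iff: "A \<in> \<Lambda> \<longleftrightarrow> (\<forall>i j. A $ i $ j / \<pi> ^ \<alpha> i j \<in> R)"
  by (simp add: tiled_order_def in_P_power_iff)

lemma order_nth_in:
  assumes "A \<in> \<Lambda>" shows "A $ i $ j \<in> R"
proof -
  have "A $ i $ j / \<pi> ^ \<alpha> i j * \<pi> ^ \<alpha> i j \<in> R"
    using assms uniformizer_in by (auto simp: order_iff power_closed simp del: times_divide_eq_left)
  then show ?thesis using uniformizer_nonzero by simp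
qed

lemma order_mult:
  assumes "A \<in> \<Lambda>" "B \<in> \<Lambda>" shows "A ** B \<in> \<Lambda>"
  unfolding order_iff
proof (intro allI)
  fix i j
  \<comment> \<open>By the triangle inequality the subtraction of naturals in the last exponent does
    not truncate.\<close>
  have "A $ i $ k * B $ k $ j / \<pi> ^ \<alpha> i j
      = (A $ i $ k / \<pi> ^ \<alpha> i k) * (B $ k $ j / \<pi> ^ \<alpha> k j) * \<pi> ^ (\<alpha> i k + \<alpha> k j - \<alpha> i j)" for k
    using uniformizer_nonzero exponent_triangle[of i j k] by (simp add: power_diff power_add)
  then have "A $ i $ k * B $ k $ j / \<pi> ^ \<alpha> i j \<in> R" for k
    using assms uniformizer_in
    by (simp add: order_iff power_closed del: times_divide_eq_left times_divide_eq_right)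
  then show "(A ** B) $ i $ j / \<pi> ^ \<alpha> i j \<in> R"
    by (simp add: matrix_matrix_mult_def sum_divide_distrib sum_closed)
qed

lemma order_add: "A \<in> \<Lambda> \<Longrightarrow> B \<in> \<Lambda> \<Longrightarrow> A + B \<in> \<Lambda>"
  by (simp add: order_iff add_divide_distrib)

lemma order_one: "mat 1 \<in> \<Lambda>"
  by (auto simp: order_iff mat_def)

lemma order_zero: "0 \<in> \<Lambda>"
  by (simp add: order_iff)

lemma order_scalar: "r \<in> R \<Longrightarrow> A \<in> \<Lambda> \<Longrightarrow> mat r ** A \<in> \<Lambda>"
  by (simp add: order_iff mat_mult_nth del: times_divide_eq_right add: times_divide_eq_right[symmetric])

text \<open>The scalar \<open>c\<close> is carried along because off the diagonal only multiples of
  \<open>\<pi> ^ \<alpha> i j\<close> are allowed; \<open>c = 1\<close> is safe for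
  \<open>i = j\<close>.\<close>

lemma order_matrix_unit: "c / \<pi> ^ \<alpha> i j \<in> R \<Longrightarrow> matrix_unit i j c \<in> \<Lambda>"
  by (simp add: order_iff matrix_unit_nth)

lemma order_idempotent: "matrix_unit i i 1 \<in> \<Lambda>"
  by (simp add: order_matrix_unit)

section \<open>The group of automorphisms over \<open>R\<close>\<close>

lemma Aut_iff:
  "\<phi> \<in> carrier Aut \<longleftrightarrow>
     \<phi> \<in> extensional \<Lambda> \<and> bij_betw \<phi> \<Lambda> \<Lambda> \<and>
     (\<forall>A\<in>\<Lambda>. \<forall>B\<in>\<Lambda>. \<phi> (A ** B) = \<phi> A ** \<phi> B) \<and>
     (\<forall>A\<in>\<Lambda>. \<forall>B\<in>\<Lambda>. \<phi> (A + B) = \<phi> A + \<phi> B) \<and>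
     \<phi> (mat 1) = mat 1 \<and>
     (\<forall>r\<in>R. \<forall>A\<in>\<Lambda>. \<phi> (mat r ** A) = mat r ** \<phi> A)"
  by (auto simp: AutR_def Bij_def ring_hom_def dest: bij_betwE)

lemma Aut_closed: "\<phi> \<in> carrier Aut \<Longrightarrow> A \<in> \<Lambda> \<Longrightarrow> \<phi> A \<in> \<Lambda>"
  by (auto simp: Aut_iff dest: bij_betwE)

lemma Aut_extensional: "\<phi> \<in> carrier Aut \<Longrightarrow> \<phi> \<in> extensional \<Lambda>"
  by (simp add: Aut_iff)

lemma Aut_inj: "\<phi> \<in> carrier Aut \<Longrightarrow> inj_on \<phi> \<Lambda>"
  by (simp add: Aut_iff bij_betw_def)

lemma Aut_mult: "\<phi> \<in> carrier Aut \<Longrightarrow> A \<in> \<Lambda> \<Longrightarrow> B \<in> \<Lambda> \<Longrightarrow> \<phi> (A ** B) = \<phi> A ** \<phi> B"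
  by (simp add: Aut_iff)

lemma Aut_add: "\<phi> \<in> carrier Aut \<Longrightarrow> A \<in> \<Lambda> \<Longrightarrow> B \<in> \<Lambda> \<Longrightarrow> \<phi> (A + B) = \<phi> A + \<phi> B"
  by (simp add: Aut_iff)

lemma Aut_one: "\<phi> \<in> carrier Aut \<Longrightarrow> \<phi> (mat 1) = mat 1"
  by (simp add: Aut_iff)

lemma Aut_scalar: "\<phi> \<in> carrier Aut \<Longrightarrow> r \<in> R \<Longrightarrow> A \<in> \<Lambda> \<Longrightarrow> \<phi> (mat r ** A) = mat r ** \<phi> A"
  by (simp add: Aut_iff)

lemma Aut_zero: "\<phi> \<in> carrier Aut \<Longrightarrow> \<phi> 0 = 0"
  using Aut_add[of \<phi> 0 0] order_zero by simp

lemma Aut_ring_hom: "\<phi> \<in> carrier Aut \<Longrightarrow> \<phi> \<in> ring_hom (tiled_ring R \<pi> \<alpha>) (tiled_ring R \<pi> \<alpha>)"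
  by (simp add: AutR_def)

lemma Aut_subgroup: "subgroup (carrier Aut) (BijGroup \<Lambda>)"
proof (rule group.subgroupI[OF group_BijGroup])
  show "carrier Aut \<subseteq> carrier (BijGroup \<Lambda>)"
    by (auto simp: AutR_def BijGroup_def)
  have "(\<lambda>A\<in>\<Lambda>. A) \<in> carrier Aut"
    by (simp add: Aut_iff bij_betw_def inj_on_def order_mult order_add order_one order_scalar)
  then show "carrier Aut \<noteq> {}" by blast
next
  fix \<phi> assume \<phi>: "\<phi> \<in> carrier Aut"
  then have B: "\<phi> \<in> Bij \<Lambda>" by (simp add: AutR_def)
  define \<psi> where "\<psi> = (\<lambda>A\<in>\<Lambda>. inv_into \<Lambda> \<phi> A)"
  have \<psi>: "\<psi> A \<in> \<Lambda>" "\<phi> (\<psi> A) = A" if "A \<in> \<Lambda>" for A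
    using \<phi> that bij_betw_inv_into_right[of \<phi> \<Lambda> \<Lambda>] Bij_inv_into_mem[OF B]
    by (auto simp: \<psi>_def Aut_iff)
  \<comment> \<open>Each homomorphism law for the inverse map follows from this: it is enough to
    compare both sides after applying \<open>\<phi>\<close>.\<close>
  have inj: "\<psi> A = B" if "A \<in> \<Lambda>" "B \<in> \<Lambda>" "A = \<phi> B" for A B
    using inj_onD[OF Aut_inj[OF \<phi>], of "\<psi> A" B] that \<psi>[of A] by simp
  have "\<psi> \<in> carrier Aut"
    unfolding Aut_iff
  proof (intro conjI ballI)
    show "\<psi> \<in> extensional \<Lambda>" by (simp add: \<psi>_def)
    show "bij_betw \<psi> \<Lambda> \<Lambda>"
      using restrict_inv_into_Bij[OF B] by (simp add: \<psi>_def Bij_def)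
  qed (auto intro!: inj simp: \<psi> \<phi> order_mult order_add order_one order_scalar
      Aut_mult Aut_add Aut_one Aut_scalar)
  then show "inv\<^bsub>BijGroup \<Lambda>\<^esub> \<phi> \<in> carrier Aut"
    using inv_BijGroup[OF B] by (simp add: \<psi>_def)
next
  fix \<phi> \<psi> assume *: "\<phi> \<in> carrier Aut" "\<psi> \<in> carrier Aut"
  then have "\<phi> \<otimes>\<^bsub>BijGroup \<Lambda>\<^esub> \<psi> = compose \<Lambda> \<phi> \<psi>"
    by (simp add: BijGroup_def AutR_def)
  moreover have "compose \<Lambda> \<phi> \<psi> \<in> carrier Aut"
    unfolding Aut_iff
  proof (intro conjI ballI)
    show "bij_betw (compose \<Lambda> \<phi> \<psi>) \<Lambda> \<Lambda>"
      using * by (auto simp: Aut_iff intro: bij_betw_compose)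
  qed (auto simp: compose_def * order_mult order_add order_one order_scalar Aut_closed
      Aut_mult Aut_add Aut_one Aut_scalar)
  ultimately show "\<phi> \<otimes>\<^bsub>BijGroup \<Lambda>\<^esub> \<psi> \<in> carrier Aut" by simp
qed

sublocale Aut: group Aut
proof -
  have "Aut = (BijGroup \<Lambda>)\<lparr>carrier := carrier Aut\<rparr>"
    by (simp add: AutR_def)
  then show "group Aut"
    using subgroup.subgroup_is_group[OF Aut_subgroup group_BijGroup] by simp
qed

lemma Aut_mult_eq: "\<phi> \<in> carrier Aut \<Longrightarrow> \<psi> \<in> carrier Aut \<Longrightarrow> \<phi> \<otimes>\<^bsub>Aut\<^esub> \<psi> = compose \<Lambda> \<phi> \<psi>"
  by (simp add: AutR_def BijGroup_def)

lemma Aut_mult_apply: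
  "\<phi> \<in> carrier Aut \<Longrightarrow> \<psi> \<in> carrier Aut \<Longrightarrow> A \<in> \<Lambda> \<Longrightarrow> (\<phi> \<otimes>\<^bsub>Aut\<^esub> \<psi>) A = \<phi> (\<psi> A)"
  by (simp add: Aut_mult_eq compose_eq)

lemma Aut_one_eq: "\<one>\<^bsub>Aut\<^esub> = (\<lambda>A\<in>\<Lambda>. A)"
  by (simp add: AutR_def BijGroup_def)

lemma Aut_inv_apply:
  assumes "\<phi> \<in> carrier Aut" "A \<in> \<Lambda>"
  shows "(inv\<^bsub>Aut\<^esub> \<phi>) (\<phi> A) = A" "\<phi> ((inv\<^bsub>Aut\<^esub> \<phi>) A) = A"
  using Aut_mult_apply[of "inv\<^bsub>Aut\<^esub> \<phi>" \<phi> A] Aut_mult_apply[of \<phi> "inv\<^bsub>Aut\<^esub> \<phi>" A] assms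
  by (simp_all add: Aut_one_eq)

lemma Aut_inv_image:
  assumes "\<phi> \<in> carrier Aut" "I \<subseteq> \<Lambda>"
  shows "(inv\<^bsub>Aut\<^esub> \<phi>) ` \<phi> ` I = I" "\<phi> ` (inv\<^bsub>Aut\<^esub> \<phi>) ` I = I"
  using assms by (force simp: image_iff subset_iff Aut_inv_apply)+

section \<open>Conjugations\<close>

text \<open>The map taking \<open>A\<close> to \<open>X ** A ** Y\<close> is a two-sided inverse of
  the conjugation, so the two stability conditions give a bijection of the order.\<close>

lemma conj_by_in_Aut:
  assumes YX: "Y ** X = mat 1"
    and YAX: "\<And>A. A \<in> \<Lambda> \<Longrightarrow> Y ** A ** X \<in> \<Lambda>"
    and XAY: "\<And>A. A \<in> \<Lambda> \<Longrightarrow> X ** A ** Y \<in> \<Lambda>"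
  shows "conj_by \<Lambda> X \<in> carrier Aut"
proof -
  have XY: "X ** Y = mat 1"
    using YX by (simp add: matrix_left_right_inverse)
  note apply_eq = conj_by_apply[OF YX]
  have cancel: "X ** (Y ** B) = B" "Y ** (X ** B) = B" for B :: "'k^'n^'n"
    using XY YX by (simp_all add: matrix_mul_assoc)
  have sandwich: "X ** (Y ** B ** X) ** Y = B" "Y ** (X ** B ** Y) ** X = B" for B :: "'k^'n^'n"
    by (simp_all add: cancel XY YX flip: matrix_mul_assoc)
  have "bij_betw (conj_by \<Lambda> X) \<Lambda> \<Lambda>"
    by (rule bij_betw_byWitness[where f' = "\<lambda>A. X ** A ** Y"])
      (auto simp: apply_eq YAX XAY sandwich)
  moreover have "Y ** (A ** B) ** X = (Y ** A ** X) ** (Y ** B ** X)" for A B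
    by (simp add: cancel flip: matrix_mul_assoc)
  moreover have "Y ** (mat r ** A) ** X = mat r ** (Y ** A ** X)" for r A
    by (metis mat_mult_commute matrix_mul_assoc)
  ultimately show ?thesis
    by (auto simp: Aut_iff conj_by_extensional apply_eq order_mult order_add order_one order_scalar
        matrix_add_ldistrib matrix_add_rdistrib YX)
qed

text \<open>The factors are reversed because conjugation puts the inverse on the left, while the
  group composes maps from right to left.\<close>

lemma conj_by_mult:
  assumes "X' ** X = mat 1" "Y' ** Y = mat 1"
    and "conj_by \<Lambda> X \<in> carrier Aut" "conj_by \<Lambda> Y \<in> carrier Aut"
  shows "conj_by \<Lambda> X \<otimes>\<^bsub>Aut\<^esub> conj_by \<Lambda> Y = conj_by \<Lambda> (Y ** X)"
proof (rule extensionalityI[where A = \<Lambda>])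
  have "(X' ** Y') ** (Y ** X) = X' ** (Y' ** Y) ** X"
    by (simp flip: matrix_mul_assoc)
  then have inv: "(X' ** Y') ** (Y ** X) = mat 1"
    using assms by simp
  fix A assume A: "A \<in> \<Lambda>"
  have "(conj_by \<Lambda> X \<otimes>\<^bsub>Aut\<^esub> conj_by \<Lambda> Y) A = X' ** (Y' ** A ** Y) ** X"
    using assms A Aut_closed[OF assms(4) A]
    by (simp add: Aut_mult_apply conj_by_apply)
  also have "\<dots> = (X' ** Y') ** A ** (Y ** X)"
    by (simp flip: matrix_mul_assoc)
  also have "\<dots> = conj_by \<Lambda> (Y ** X) A"
    using conj_by_apply[OF inv A] by simp
  finally show "(conj_by \<Lambda> X \<otimes>\<^bsub>Aut\<^esub> conj_by \<Lambda> Y) A = conj_by \<Lambda> (Y ** X) A" .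
qed (use assms in \<open>simp_all add: Aut_mult_eq conj_by_extensional\<close>)

lemma conj_by_one: "conj_by \<Lambda> (mat 1) = \<one>\<^bsub>Aut\<^esub>"
proof (rule extensionalityI[where A = \<Lambda>])
  show "conj_by \<Lambda> (mat 1) A = \<one>\<^bsub>Aut\<^esub> A" if "A \<in> \<Lambda>" for A
    using that conj_by_apply[of "mat 1" "mat 1" A \<Lambda>] by (simp add: Aut_one_eq)
qed (simp_all add: Aut_one_eq conj_by_extensional)

section \<open>Inner automorphisms\<close>

lemma Units_iff:
  "u \<in> Units (tiled_ring R \<pi> \<alpha>) \<longleftrightarrow> u \<in> \<Lambda> \<and> (\<exists>v\<in>\<Lambda>. v ** u = mat 1 \<and> u ** v = mat 1)"
  by (auto simp: Units_def)

lemma conj_by_unit_in_Aut: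
  assumes "u \<in> Units (tiled_ring R \<pi> \<alpha>)"
  shows "conj_by \<Lambda> u \<in> carrier Aut"
  using assms by (auto simp: Units_iff intro!: conj_by_in_Aut order_mult)

lemma Inn_subgroup: "subgroup (Inn R \<pi> \<alpha>) Aut"
proof (rule Aut.subgroupI)
  show "Inn R \<pi> \<alpha> \<subseteq> carrier Aut"
    by (auto simp: Inn_def conj_by_unit_in_Aut)
  have "mat 1 \<in> Units (tiled_ring R \<pi> \<alpha>)"
    using order_one by (auto simp: Units_iff)
  then show "Inn R \<pi> \<alpha> \<noteq> {}"
    by (auto simp: Inn_def)
next
  fix \<phi> assume "\<phi> \<in> Inn R \<pi> \<alpha>"
  then obtain u v where u: "u \<in> \<Lambda>" "v \<in> \<Lambda>" "v ** u = mat 1" "u ** v = mat 1" "\<phi> = conj_by \<Lambda> u"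
    by (auto simp: Inn_def Units_iff)
  then have units: "u \<in> Units (tiled_ring R \<pi> \<alpha>)" "v \<in> Units (tiled_ring R \<pi> \<alpha>)"
    by (auto simp: Units_iff)
  then have "conj_by \<Lambda> v \<otimes>\<^bsub>Aut\<^esub> \<phi> = \<one>\<^bsub>Aut\<^esub>"
    using u by (simp add: conj_by_mult[of u _ v] conj_by_unit_in_Aut conj_by_one)
  then have "inv\<^bsub>Aut\<^esub> \<phi> = conj_by \<Lambda> v"
    using units u by (intro Aut.inv_equality) (auto simp: conj_by_unit_in_Aut)
  then show "inv\<^bsub>Aut\<^esub> \<phi> \<in> Inn R \<pi> \<alpha>"
    using units by (simp add: Inn_def)
next
  fix \<phi> \<psi> assume "\<phi> \<in> Inn R \<pi> \<alpha>" "\<psi> \<in> Inn R \<pi> \<alpha>"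
  then obtain u v u' v' where u: "u \<in> \<Lambda>" "v \<in> \<Lambda>" "v ** u = mat 1" "u ** v = mat 1" "\<phi> = conj_by \<Lambda> u"
    and u': "u' \<in> \<Lambda>" "v' \<in> \<Lambda>" "v' ** u' = mat 1" "u' ** v' = mat 1" "\<psi> = conj_by \<Lambda> u'"
    by (auto simp: Inn_def Units_iff)
  have "(v ** v') ** (u' ** u) = v ** (v' ** u') ** u" "(u' ** u) ** (v ** v') = u' ** (u ** v) ** v'"
    by (simp_all flip: matrix_mul_assoc)
  then have "u' ** u \<in> Units (tiled_ring R \<pi> \<alpha>)"
    using u u' by (auto simp: Units_iff order_mult intro!: bexI[of _ "v ** v'"])
  moreover have "\<phi> \<otimes>\<^bsub>Aut\<^esub> \<psi> = conj_by \<Lambda> (u' ** u)"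
    unfolding \<open>\<phi> = _\<close> \<open>\<psi> = _\<close>
    by (rule conj_by_mult[OF u(3) u'(3)]; rule conj_by_unit_in_Aut)
      (use u u' in \<open>auto simp: Units_iff\<close>)
  ultimately show "\<phi> \<otimes>\<^bsub>Aut\<^esub> \<psi> \<in> Inn R \<pi> \<alpha>"
    by (simp add: Inn_def)
qed

text \<open>Conjugating the inner automorphism of \<open>u\<close> by \<open>\<phi>\<close> gives
  the inner automorphism of \<open>\<phi> u\<close>.\<close>

lemma Inn_normal: "Inn R \<pi> \<alpha> \<lhd> Aut"
  unfolding Aut.normal_inv_iff
proof (intro conjI ballI Inn_subgroup)
  fix \<phi> \<psi> assume \<phi>: "\<phi> \<in> carrier Aut" and "\<psi> \<in> Inn R \<pi> \<alpha>"
  then obtain u v where u: "u \<in> \<Lambda>" "v \<in> \<Lambda>" "v ** u = mat 1" "u ** v = mat 1"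
    and \<psi>: "\<psi> = conj_by \<Lambda> u"
    by (auto simp: Inn_def Units_iff)
  then have u_unit: "u \<in> Units (tiled_ring R \<pi> \<alpha>)"
    by (auto simp: Units_iff)
  from u have inverse: "\<phi> v ** \<phi> u = mat 1" "\<phi> u ** \<phi> v = mat 1"
    using \<phi> by (simp_all add: Aut_one flip: Aut_mult)
  then have unit: "\<phi> u \<in> Units (tiled_ring R \<pi> \<alpha>)"
    using \<phi> u by (auto simp: Units_iff Aut_closed)
  have "\<phi> \<otimes>\<^bsub>Aut\<^esub> \<psi> \<otimes>\<^bsub>Aut\<^esub> inv\<^bsub>Aut\<^esub> \<phi> = conj_by \<Lambda> (\<phi> u)"
  proof (rule extensionalityI[where A = \<Lambda>])
    fix A assume A: "A \<in> \<Lambda>"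
    define B where "B = (inv\<^bsub>Aut\<^esub> \<phi>) A"
    have B: "B \<in> \<Lambda>" "\<phi> B = A"
      using A \<phi> by (simp_all add: B_def Aut_closed Aut_inv_apply)
    then have "(\<phi> \<otimes>\<^bsub>Aut\<^esub> \<psi> \<otimes>\<^bsub>Aut\<^esub> inv\<^bsub>Aut\<^esub> \<phi>) A = \<phi> (v ** B ** u)"
      using \<phi> u A by (simp add: \<psi> Aut_mult_apply conj_by_unit_in_Aut u_unit conj_by_apply[OF u(3)] flip: B_def)
    also have "\<dots> = \<phi> v ** A ** \<phi> u"
      using \<phi> u B by (simp add: Aut_mult order_mult)
    finally show "(\<phi> \<otimes>\<^bsub>Aut\<^esub> \<psi> \<otimes>\<^bsub>Aut\<^esub> inv\<^bsub>Aut\<^esub> \<phi>) A = conj_by \<Lambda> (\<phi> u) A"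
      using conj_by_apply[OF inverse(1) A] by simp
  qed (use \<phi> u_unit in \<open>simp_all add: \<psi> Aut_extensional conj_by_unit_in_Aut conj_by_extensional\<close>)
  then show "\<phi> \<otimes>\<^bsub>Aut\<^esub> \<psi> \<otimes>\<^bsub>Aut\<^esub> inv\<^bsub>Aut\<^esub> \<phi> \<in> Inn R \<pi> \<alpha>"
    using unit by (simp add: Inn_def)
qed

text \<open>The \<open>(i, j)\<close> corner is a rank one module generated by
  \<open>\<pi> ^ \<alpha> i j\<close>. Its generator, rescaled by \<open>t j / t i\<close>, must
  generate the corner at \<open>(\<sigma> i, \<sigma> j)\<close>, so the ratio of the two generators
  must be a unit.\<close>

lemma monomial_conj_in_Aut_iff:
  assumes \<sigma>: "\<sigma> permutes UNIV" and t: "\<And>i. t i \<noteq> 0"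
  shows "conj_by \<Lambda> (monomial_matrix t \<sigma>) \<in> carrier Aut \<longleftrightarrow>
    (\<forall>i j. (t j / t i) * \<pi> ^ \<alpha> i j / \<pi> ^ \<alpha> (\<sigma> i) (\<sigma> j) \<in> unit_group)"
    (is "?\<phi> \<in> carrier Aut \<longleftrightarrow> (\<forall>i j. ?u i j \<in> unit_group)")
proof
  note entry = conj_by_monomial_nth[where S = \<Lambda>, OF \<sigma> t]
  assume \<phi>: "?\<phi> \<in> carrier Aut"
  show "\<forall>i j. ?u i j \<in> unit_group"
  proof (intro allI)
    fix i j
    have "matrix_unit i j (\<pi> ^ \<alpha> i j) \<in> \<Lambda>" (is "?A \<in> \<Lambda>")
      using uniformizer_nonzero by (simp add: order_matrix_unit)
    then have "?\<phi> ?A $ \<sigma> i $ \<sigma> j / \<pi> ^ \<alpha> (\<sigma> i) (\<sigma> j) \<in> R"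
      using Aut_closed[OF \<phi>] by (simp add: order_iff)
    then have u: "?u i j \<in> R"
      using \<open>?A \<in> \<Lambda>\<close> by (simp add: entry matrix_unit_nth mult.commute)
    \<comment> \<open>Surjectivity yields a preimage of the target generator; its
      \<open>(i, j)\<close> entry divided by \<open>\<pi> ^ \<alpha> i j\<close> is the inverse of
      the ratio.\<close>
    have "matrix_unit (\<sigma> i) (\<sigma> j) (\<pi> ^ \<alpha> (\<sigma> i) (\<sigma> j)) \<in> \<Lambda>"
      using uniformizer_nonzero by (simp add: order_matrix_unit)
    then obtain B where B: "B \<in> \<Lambda>" "?\<phi> B = matrix_unit (\<sigma> i) (\<sigma> j) (\<pi> ^ \<alpha> (\<sigma> i) (\<sigma> j))"
      using \<phi> unfolding Aut_iff bij_betw_def by (metis imageE)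
    moreover have "?\<phi> B $ \<sigma> i $ \<sigma> j = B $ i $ j * (t j / t i)"
      using B(1) by (rule entry)
    ultimately have "\<pi> ^ \<alpha> (\<sigma> i) (\<sigma> j) = B $ i $ j * (t j / t i)"
      by (simp add: matrix_unit_nth)
    then have "inverse (?u i j) = B $ i $ j / \<pi> ^ \<alpha> i j"
      using t[of i] t[of j] uniformizer_nonzero by (simp add: field_simps)
    then show "?u i j \<in> unit_group"
      using u B t uniformizer_nonzero by (simp add: unit_group_def order_iff)
  qed
next
  assume "\<forall>i j. ?u i j \<in> unit_group"
  then have u_in: "?u i j \<in> R" "inverse (?u i j) \<in> R" for i j
    unfolding unit_group_def by blast+
  show "?\<phi> \<in> carrier Aut"
  proof (rule conj_by_in_Aut[OF monomial_matrix_mult_inverse(2)[OF \<sigma> t]])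
    fix A assume A: "A \<in> \<Lambda>"
    let ?X = "monomial_matrix t \<sigma>" and ?Y = "monomial_inverse t \<sigma>"
    have "(?Y ** A ** ?X) $ \<sigma> i $ \<sigma> j / \<pi> ^ \<alpha> (\<sigma> i) (\<sigma> j) = (A $ i $ j / \<pi> ^ \<alpha> i j) * ?u i j" for i j
      using permutes_inj[OF \<sigma>] uniformizer_nonzero
      by (simp add: mult_monomial_matrix_nth monomial_inverse_mult_nth field_simps)
    then have "(?Y ** A ** ?X) $ \<sigma> i $ \<sigma> j / \<pi> ^ \<alpha> (\<sigma> i) (\<sigma> j) \<in> R" for i j
      using A by (simp only: order_iff valuation_ring.m_closed u_in)
    then show "?Y ** A ** ?X \<in> \<Lambda>"
      unfolding order_iff using \<sigma> permutes_inverses(1)[OF \<sigma>] by metis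
    have "(?X ** A ** ?Y) $ i $ j / \<pi> ^ \<alpha> i j
        = (A $ \<sigma> i $ \<sigma> j / \<pi> ^ \<alpha> (\<sigma> i) (\<sigma> j)) * inverse (?u i j)" for i j
      using t[of i] t[of j] uniformizer_nonzero
      by (simp add: mult_monomial_inverse_nth monomial_matrix_mult_nth field_simps)
    then show "?X ** A ** ?Y \<in> \<Lambda>"
      using A by (simp only: order_iff valuation_ring.m_closed u_in simp_thms)
  qed
qed

text \<open>The criterion only sees valuations, so the units \<open>\<eta> i\<close> have no
  influence on the exponents.\<close>

lemma solves_full_system_of_monomial_conj:
  assumes \<sigma>: "\<sigma> permutes UNIV" and \<eta>: "\<And>i. \<eta> i \<in> unit_group"
    and \<phi>: "conj_by \<Lambda> (monomial_matrix (\<lambda>i. \<eta> i * \<pi> powi x i) \<sigma>) \<in> carrier Aut"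
  shows "solves_full_system \<alpha> \<sigma> x"
  unfolding solves_full_system_def
proof (intro allI)
  fix i j
  have \<eta>0: "\<eta> i \<noteq> 0" for i using \<eta> by (simp add: unit_group_def)
  let ?u = "(\<eta> j * \<pi> powi x j) / (\<eta> i * \<pi> powi x i) * \<pi> ^ \<alpha> i j / \<pi> ^ \<alpha> (\<sigma> i) (\<sigma> j)"
  have "?u \<in> unit_group"
    using monomial_conj_in_Aut_iff[OF \<sigma>, of "\<lambda>i. \<eta> i * \<pi> powi x i"] \<phi> \<eta>0 uniformizer_nonzero by simp
  \<comment> \<open>Cancelling the unit part leaves a pure power of \<open>\<pi>\<close>, which is a
    unit only for exponent 0.\<close>
  then have "\<eta> i * inverse (\<eta> j) * ?u \<in> unit_group"
    using \<eta> by (intro unit_group_mult unit_group_inverse)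
  moreover have "\<eta> i * inverse (\<eta> j) * ?u
      = \<pi> powi (x j - x i + int (\<alpha> i j) - int (\<alpha> (\<sigma> i) (\<sigma> j)))"
    using \<eta>0[of i] \<eta>0[of j] uniformizer_nonzero by (simp add: power_int_diff power_int_add field_simps)
  ultimately have "x j - x i + int (\<alpha> i j) - int (\<alpha> (\<sigma> i) (\<sigma> j)) = 0"
    by (simp add: uniformizer_powi_in_unit_group_iff)
  then show "x i - x j = int (\<alpha> i j) - int (\<alpha> (\<sigma> i) (\<sigma> j))"
    by simp
qed

lemma diag_perm_conj_in_Aut_iff:
  assumes \<sigma>: "\<sigma> permutes UNIV"
  shows "conj_by \<Lambda> (diag_pow \<pi> x ** perm_matrix \<sigma>) \<in> carrier Aut \<longleftrightarrow> solves_full_system \<alpha> \<sigma> x"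
proof
  assume "conj_by \<Lambda> (diag_pow \<pi> x ** perm_matrix \<sigma>) \<in> carrier Aut"
  then show "solves_full_system \<alpha> \<sigma> x"
    using solves_full_system_of_monomial_conj[OF \<sigma>, of "\<lambda>_. 1" x] one_in_unit_group
    by (simp add: diag_pow_mult_perm_matrix)
next
  assume x: "solves_full_system \<alpha> \<sigma> x"
  have "(\<pi> powi x j / \<pi> powi x i) * \<pi> ^ \<alpha> i j / \<pi> ^ \<alpha> (\<sigma> i) (\<sigma> j) \<in> unit_group" for i j
  proof -
    have "(\<pi> powi x j / \<pi> powi x i) * \<pi> ^ \<alpha> i j / \<pi> ^ \<alpha> (\<sigma> i) (\<sigma> j)
        = \<pi> powi (x j - x i + int (\<alpha> i j) - int (\<alpha> (\<sigma> i) (\<sigma> j)))"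
      using uniformizer_nonzero by (simp add: power_int_diff power_int_add)
    moreover have "x j - x i + int (\<alpha> i j) - int (\<alpha> (\<sigma> i) (\<sigma> j)) = 0"
      using x[unfolded solves_full_system_def, rule_format, of i j] by simp
    ultimately show ?thesis
      using one_in_unit_group by (metis power_int_0_right)
  qed
  then show "conj_by \<Lambda> (diag_pow \<pi> x ** perm_matrix \<sigma>) \<in> carrier Aut"
    using monomial_conj_in_Aut_iff[OF \<sigma>] uniformizer_nonzero
    by (simp add: diag_pow_mult_perm_matrix)
qed

section \<open>The permutation of the maximal ideals\<close>

abbreviation M where
  "M \<equiv> max_ideal R \<pi> \<alpha>"

lemma M_iff: "A \<in> M k \<longleftrightarrow> A \<in> \<Lambda> \<and> A $ k $ k \<notin> unit_group"
  using unit_iff_notin_P_power_1[OF order_nth_in[of A k k]] by (auto simp: max_ideal_def)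

text \<open>Each diagonal idempotent avoids exactly one of the maximal ideals and so serves as a
  marker for it.\<close>

lemma idempotent_in_M_iff: "matrix_unit i i 1 \<in> M k \<longleftrightarrow> i \<noteq> k"
  using one_in_unit_group
  by (auto simp: M_iff order_idempotent matrix_unit_nth unit_group_def)

lemma M_subset: "M k \<subseteq> \<Lambda>"
  by (auto simp: M_iff)

lemma M_subset_M_iff: "M i \<subseteq> M j \<longleftrightarrow> i = j"
  using idempotent_in_M_iff by blast

lemma M_maximal: "maximalideal (M k) (tiled_ring R \<pi> \<alpha>)"
  using standard unfolding standard_max_ideals_def bij_betw_def by blast

lemma maximal_eq_M:
  assumes "maximalideal I (tiled_ring R \<pi> \<alpha>)"
  obtains k where "I = M k"
proof -
  have "I \<in> range M"
    using standard assms by (simp add: standard_max_ideals_def bij_betw_def)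
  then show thesis using that by blast
qed

lemma M_ideal: "ideal (M k) (tiled_ring R \<pi> \<alpha>)"
  using M_maximal by (rule maximalideal.axioms(1))

text \<open>The ring axioms are part of the notion of an ideal, so any one of the given maximal
  ideals supplies them.\<close>

lemma ring_order: "ring (tiled_ring R \<pi> \<alpha>)"
  using M_ideal by (rule ideal.axioms(2))

text \<open>The image is the preimage under the inverse automorphism, and preimages of ideals under
  ring homomorphisms are ideals.\<close>

lemma Aut_image_ideal:
  assumes \<phi>: "\<phi> \<in> carrier Aut" and I: "ideal I (tiled_ring R \<pi> \<alpha>)"
  shows "ideal (\<phi> ` I) (tiled_ring R \<pi> \<alpha>)"
proof -
  have sub: "I \<subseteq> \<Lambda>"
    using ideal.Icarr[OF I] by auto
  let ?\<psi> = "inv\<^bsub>Aut\<^esub> \<phi>"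
  have \<psi>: "?\<psi> \<in> carrier Aut" using \<phi> by simp
  then have hom: "ring_hom_ring (tiled_ring R \<pi> \<alpha>) (tiled_ring R \<pi> \<alpha>) ?\<psi>"
    using Aut_ring_hom ring_order by (blast intro: ring_hom_ringI2)
  have "\<phi> ` I = {A \<in> \<Lambda>. ?\<psi> A \<in> I}"
  proof (intro equalityI subsetI)
    fix A assume "A \<in> \<phi> ` I"
    then show "A \<in> {A \<in> \<Lambda>. ?\<psi> A \<in> I}"
      using \<phi> sub by (auto simp: Aut_closed Aut_inv_apply subset_iff)
  next
    fix A assume "A \<in> {A \<in> \<Lambda>. ?\<psi> A \<in> I}"
    then show "A \<in> \<phi> ` I"
      using \<phi> by (metis (no_types, lifting) Aut_inv_apply(2) imageI mem_Collect_eq)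
  qed
  then show ?thesis
    using ring_hom_ring.ideal_vimage[OF hom I] by simp
qed

lemma Aut_image_maximal:
  assumes \<phi>: "\<phi> \<in> carrier Aut" and I: "maximalideal I (tiled_ring R \<pi> \<alpha>)"
  shows "maximalideal (\<phi> ` I) (tiled_ring R \<pi> \<alpha>)"
proof -
  let ?\<psi> = "inv\<^bsub>Aut\<^esub> \<phi>"
  have \<psi>: "?\<psi> \<in> carrier Aut" using \<phi> by simp
  have ideal_I: "ideal I (tiled_ring R \<pi> \<alpha>)"
    using I by (rule maximalideal.axioms(1))
  have sub: "I \<subseteq> \<Lambda>"
    using ideal.Icarr[OF ideal_I] by auto
  have image_order: "\<rho> ` \<Lambda> = \<Lambda>" if "\<rho> \<in> carrier Aut" for \<rho>
    using that by (simp add: Aut_iff bij_betw_def)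
  show ?thesis
  proof (rule maximalidealI)
    show "ideal (\<phi> ` I) (tiled_ring R \<pi> \<alpha>)"
      using \<phi> ideal_I by (rule Aut_image_ideal)
    show "carrier (tiled_ring R \<pi> \<alpha>) \<noteq> \<phi> ` I"
      using maximalideal.I_notcarr[OF I] Aut_inv_image[OF \<phi> sub] image_order[OF \<psi>] by auto
  next
    fix J assume J: "ideal J (tiled_ring R \<pi> \<alpha>)" "\<phi> ` I \<subseteq> J" "J \<subseteq> carrier (tiled_ring R \<pi> \<alpha>)"
    then have "I \<subseteq> ?\<psi> ` J" "?\<psi> ` J \<subseteq> \<Lambda>"
      using Aut_inv_image[OF \<phi> sub] image_order[OF \<psi>] image_mono[OF J(2), of ?\<psi>]
        image_mono[OF J(3), of ?\<psi>] by simp_all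
    then have "?\<psi> ` J = I \<or> ?\<psi> ` J = \<Lambda>"
      using maximalideal.I_maximal[OF I Aut_image_ideal[OF \<psi> J(1)]] by simp
    then show "J = \<phi> ` I \<or> J = carrier (tiled_ring R \<pi> \<alpha>)"
      using Aut_inv_image(2)[OF \<phi>, of J] J(3) image_order[OF \<phi>] by auto
  qed
qed

text \<open>Automorphisms send maximal ideals to maximal ideals injectively, and an injection of a
  finite type is a permutation. It is unique since the ideals \<open>M k\<close> are distinct, which
  makes the description in \<open>Phi\<close> well defined.\<close>

lemma Phi_properties:
  assumes \<phi>: "\<phi> \<in> carrier Aut"
  shows Phi_permutes: "Phi R \<pi> \<alpha> \<phi> permutes UNIV"
    and image_M: "\<phi> ` M i = M (Phi R \<pi> \<alpha> \<phi> i)"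
proof -
  let ?P = "\<lambda>\<sigma>. \<sigma> permutes UNIV \<and> (\<forall>i. \<phi> ` M i = M (\<sigma> i))"
  have "\<exists>k. \<phi> ` M i = M k" for i
    using maximal_eq_M[OF Aut_image_maximal[OF \<phi> M_maximal]] by blast
  then have "\<exists>\<sigma>. \<forall>i. \<phi> ` M i = M (\<sigma> i)"
    by (intro choice allI)
  then obtain \<sigma> where \<sigma>: "\<And>i. \<phi> ` M i = M (\<sigma> i)" by blast
  have "inj \<sigma>"
  proof (rule injI)
    fix i j assume "\<sigma> i = \<sigma> j"
    then have "\<phi> ` M i = \<phi> ` M j" by (simp add: \<sigma>)
    then have "M i = M j"
      using Aut_inj[OF \<phi>] M_subset by (simp add: inj_on_image_eq_iff)
    then show "i = j" using M_subset_M_iff by blast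
  qed
  then have "\<sigma> permutes UNIV"
    using finite_UNIV_inj_surj[of \<sigma>] by (intro bij_imp_permutes) (simp_all add: bij_def)
  then have "?P \<sigma>" using \<sigma> by blast
  moreover have "\<tau> = \<sigma>" if "?P \<tau>" for \<tau>
  proof
    fix i
    have "M (\<tau> i) \<subseteq> M (\<sigma> i)" using that \<sigma> by simp
    then show "\<tau> i = \<sigma> i" by (simp add: M_subset_M_iff)
  qed
  ultimately have "?P (Phi R \<pi> \<alpha> \<phi>)"
    unfolding Phi_def by (rule theI)
  then show "Phi R \<pi> \<alpha> \<phi> permutes UNIV" "\<phi> ` M i = M (Phi R \<pi> \<alpha> \<phi> i)"
    by blast+
qed

text \<open>The idempotent at \<open>\<sigma> i\<close> lies outside the image of
  \<open>M i\<close>, and the only maximal ideal avoiding it is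
  \<open>M (\<sigma> i)\<close>.\<close>

lemma Phi_eqI:
  assumes "\<phi> \<in> carrier Aut" "\<And>i. \<phi> (matrix_unit i i 1) = matrix_unit (\<sigma> i) (\<sigma> i) 1"
  shows "Phi R \<pi> \<alpha> \<phi> = \<sigma>"
proof
  fix i
  have "matrix_unit (\<sigma> i) (\<sigma> i) 1 \<notin> \<phi> ` M i"
  proof
    assume "matrix_unit (\<sigma> i) (\<sigma> i) 1 \<in> \<phi> ` M i"
    then obtain A where "A \<in> M i" "\<phi> A = \<phi> (matrix_unit i i 1)"
      using assms(2) by (metis imageE)
    then have "matrix_unit i i 1 \<in> M i"
      using inj_onD[OF Aut_inj[OF assms(1)]] M_subset order_idempotent by blast
    then show False by (simp add: idempotent_in_M_iff)
  qed
  then show "Phi R \<pi> \<alpha> \<phi> i = \<sigma> i"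
    using image_M[OF assms(1)] by (simp add: idempotent_in_M_iff)
qed

text \<open>A two-sided ideal absorbs both factors of the conjugation, so each \<open>M i\<close> is
  mapped into itself.\<close>

lemma Phi_Inn:
  assumes "\<phi> \<in> Inn R \<pi> \<alpha>" shows "Phi R \<pi> \<alpha> \<phi> = id"
proof
  fix i
  obtain u v where u: "u \<in> \<Lambda>" "v \<in> \<Lambda>" "v ** u = mat 1" "\<phi> = conj_by \<Lambda> u"
    using assms by (auto simp: Inn_def Units_iff)
  have \<phi>: "\<phi> \<in> carrier Aut"
    using assms subgroup.subset[OF Inn_subgroup] by blast
  have "v ** A ** u \<in> M i" if "A \<in> M i" for A
    using ideal.I_l_closed[OF M_ideal that] ideal.I_r_closed[OF M_ideal] u by simp
  then have "\<phi> ` M i \<subseteq> M i"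
    using u M_subset by (auto simp: conj_by_apply subset_iff)
  then show "Phi R \<pi> \<alpha> \<phi> i = id i"
    using image_M[OF \<phi>] M_subset_M_iff by simp
qed

section \<open>Compatibility with the link graph\<close>

lemma Aut_image_ideal_prod:
  assumes \<phi>: "\<phi> \<in> carrier Aut" and "I \<subseteq> \<Lambda>" "J \<subseteq> \<Lambda>"
  shows "\<phi> ` ideal_prod (tiled_ring R \<pi> \<alpha>) I J = ideal_prod (tiled_ring R \<pi> \<alpha>) (\<phi> ` I) (\<phi> ` J)"
proof -
  \<comment> \<open>The laws for \<open>\<phi>\<close> hold on the order only, so the sums met in
    the inductions below must be known to lie there.\<close>
  have in_order: "A \<in> \<Lambda>" if "A \<in> ideal_prod (tiled_ring R \<pi> \<alpha>) I J" for A
    using that by induction (use assms in \<open>auto intro: order_mult order_add\<close>)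
  have "\<phi> A \<in> ideal_prod (tiled_ring R \<pi> \<alpha>) (\<phi> ` I) (\<phi> ` J)"
    if "A \<in> ideal_prod (tiled_ring R \<pi> \<alpha>) I J" for A
    using that
  proof induction
    case (prod i j)
    then have "\<phi> (i ** j) = \<phi> i ** \<phi> j"
      using assms by (intro Aut_mult) auto
    then show ?case
      using prod ideal_prod.prod[of "\<phi> i" "\<phi> ` I" "\<phi> j" "\<phi> ` J" "tiled_ring R \<pi> \<alpha>"] by simp
  next
    case (sum s1 s2)
    then show ?case
      using ideal_prod.sum[OF sum.IH] Aut_add[OF \<phi>] in_order by simp
  qed
  moreover have "B \<in> \<phi> ` ideal_prod (tiled_ring R \<pi> \<alpha>) I J"
    if "B \<in> ideal_prod (tiled_ring R \<pi> \<alpha>) (\<phi> ` I) (\<phi> ` J)" for B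
    using that
  proof induction
    case (prod i j)
    then obtain i' j' where *: "i' \<in> I" "j' \<in> J" "i = \<phi> i'" "j = \<phi> j'" by blast
    then have "i ** j = \<phi> (i' ** j')"
      using assms by (subst Aut_mult) auto
    then show ?case
      using * ideal_prod.prod[of i' I j' J "tiled_ring R \<pi> \<alpha>"] by simp
  next
    case (sum s1 s2)
    then obtain A B where *: "A \<in> ideal_prod (tiled_ring R \<pi> \<alpha>) I J"
      "B \<in> ideal_prod (tiled_ring R \<pi> \<alpha>) I J" "s1 = \<phi> A" "s2 = \<phi> B" by blast
    then have "s1 + s2 = \<phi> (A + B)"
      using in_order by (simp add: Aut_add[OF \<phi>])
    then show ?case
      using ideal_prod.sum[OF *(1,2)] by simp
  qed
  ultimately show ?thesis by blast
qed

text \<open>Arrows are defined by products and intersections of maximal ideals. An automorphism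
  preserves both, and its injectivity lets the equality of the images be reflected.\<close>

lemma Phi_graph_automorphism:
  assumes \<phi>: "\<phi> \<in> carrier Aut"
  shows "Phi R \<pi> \<alpha> \<phi> \<in> graph_automorphisms (link_graph R \<pi> \<alpha>)"
proof -
  let ?\<sigma> = "Phi R \<pi> \<alpha> \<phi>" and ?\<Lambda> = "tiled_ring R \<pi> \<alpha>"
  have "ideal_prod ?\<Lambda> (M (?\<sigma> j)) (M (?\<sigma> i)) = M (?\<sigma> j) \<inter> M (?\<sigma> i) \<longleftrightarrow>
      ideal_prod ?\<Lambda> (M j) (M i) = M j \<inter> M i" for i j
  proof -
    have "ideal_prod ?\<Lambda> (M (?\<sigma> j)) (M (?\<sigma> i)) = \<phi> ` ideal_prod ?\<Lambda> (M j) (M i)"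
      using Aut_image_ideal_prod[OF \<phi> M_subset M_subset] image_M[OF \<phi>] by simp
    moreover have "M (?\<sigma> j) \<inter> M (?\<sigma> i) = \<phi> ` (M j \<inter> M i)"
      using inj_on_image_Int[OF Aut_inj[OF \<phi>] M_subset M_subset] image_M[OF \<phi>] by simp
    moreover have "ideal_prod ?\<Lambda> (M j) (M i) \<subseteq> \<Lambda>"
      using ring.ideal_prod_in_carrier[OF ring_order M_ideal M_ideal] by simp
    ultimately show ?thesis
      using inj_on_image_eq_iff[OF Aut_inj[OF \<phi>]] M_subset by (simp add: le_infI1)
  qed
  then show ?thesis
    using Phi_permutes[OF \<phi>] by (simp add: graph_automorphisms_def link_graph_def)
qed

lemma Phi_liftable: "\<phi> \<in> carrier Aut \<Longrightarrow> liftable R \<pi> \<alpha> (Phi R \<pi> \<alpha> \<phi>)"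
  by (simp add: liftable_def Phi_graph_automorphism)

section \<open>The permutation induced by a monomial conjugation\<close>

lemma monomial_conj_idempotent:
  assumes "\<sigma> permutes UNIV" "\<And>i. t i \<noteq> 0"
  shows "conj_by \<Lambda> (monomial_matrix t \<sigma>) (matrix_unit k k 1) = matrix_unit (\<sigma> k) (\<sigma> k) 1"
proof -
  have "conj_by \<Lambda> (monomial_matrix t \<sigma>) (matrix_unit k k 1) $ \<sigma> i $ \<sigma> j
      = matrix_unit (\<sigma> k) (\<sigma> k) 1 $ \<sigma> i $ \<sigma> j" for i j
    using assms permutes_inj[OF assms(1)] order_idempotent
    by (simp add: conj_by_monomial_nth matrix_unit_nth inj_eq)
  then show ?thesis
    unfolding vec_eq_iff using permutes_inverses(1)[OF assms(1)] by metis
qed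

lemma Phi_diag_perm_conj:
  assumes "\<sigma> permutes UNIV" "solves_full_system \<alpha> \<sigma> x"
  shows "Phi R \<pi> \<alpha> (conj_by \<Lambda> (diag_pow \<pi> x ** perm_matrix \<sigma>)) = \<sigma>"
proof (rule Phi_eqI)
  show "conj_by \<Lambda> (diag_pow \<pi> x ** perm_matrix \<sigma>) \<in> carrier Aut"
    using assms by (simp add: diag_perm_conj_in_Aut_iff)
  show "conj_by \<Lambda> (diag_pow \<pi> x ** perm_matrix \<sigma>) (matrix_unit i i 1) = matrix_unit (\<sigma> i) (\<sigma> i) 1" for i
    unfolding diag_pow_mult_perm_matrix
    using assms(1) uniformizer_nonzero by (intro monomial_conj_idempotent) simp_all
qed

section \<open>Normal form of an automorphism\<close>

text \<open>The maximal ideals decide which diagonal entry of each image idempotent is a unit; with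
  this matching the correcting unit can be written down explicitly.\<close>

lemma straighten_idempotents:
  assumes \<phi>: "\<phi> \<in> carrier Aut"
  obtains w where "w \<in> Units (tiled_ring R \<pi> \<alpha>)"
    "\<And>i. conj_by \<Lambda> w (\<phi> (matrix_unit i i 1)) = matrix_unit (Phi R \<pi> \<alpha> \<phi> i) (Phi R \<pi> \<alpha> \<phi> i) 1"
proof -
  define \<sigma> where "\<sigma> = Phi R \<pi> \<alpha> \<phi>"
  define \<tau> where "\<tau> = inv_into UNIV \<sigma>"
  define f where "f i = \<phi> (matrix_unit i i 1)" for i
  have \<sigma>: "\<sigma> permutes UNIV" and M_\<sigma>: "\<phi> ` M i = M (\<sigma> i)" for i
    using Phi_permutes[OF \<phi>] image_M[OF \<phi>] by (simp_all add: \<sigma>_def)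
  have \<sigma>\<tau>: "\<sigma> (\<tau> i) = i" "\<tau> (\<sigma> i) = i" for i
    using permutes_inverses[OF \<sigma>] by (simp_all add: \<tau>_def)
  have f: "f i \<in> \<Lambda>" for i
    using \<phi> by (simp add: f_def Aut_closed order_idempotent)
  have ff: "f i ** f j = (if i = j then f i else 0)" for i j
    using \<phi> by (simp add: f_def order_idempotent matrix_unit_mult Aut_zero flip: Aut_mult)
  \<comment> \<open>Otherwise \<open>f i\<close> would lie in \<open>M (\<sigma> i)\<close>, the
    image of \<open>M i\<close>, and pulling back would put the \<open>i\<close>-th idempotent into
    \<open>M i\<close>.\<close>
  have f_diag: "f i $ \<sigma> i $ \<sigma> i \<in> unit_group" for i
  proof (rule ccontr)
    assume "f i $ \<sigma> i $ \<sigma> i \<notin> unit_group"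
    then have "f i \<in> \<phi> ` M i"
      using f by (simp add: M_\<sigma> M_iff)
    then have "matrix_unit i i 1 \<in> M i"
      unfolding f_def using inj_onD[OF Aut_inj[OF \<phi>]] M_subset order_idempotent by blast
    then show False by (simp add: idempotent_in_M_iff)
  qed
  define d where "d r = f (\<tau> r) $ r $ r" for r
  have d: "d r \<in> unit_group" for r
    using f_diag[of "\<tau> r"] by (simp add: d_def \<sigma>\<tau>)
  \<comment> \<open>Right multiplication by a diagonal idempotent selects a column and left
    multiplication a row, so the two sums of products become matrices assembled from columns and
    rows of the \<open>f i\<close>.\<close>
  define w where "w = (\<chi> r c. f (\<tau> c) $ r $ c)"
  define w' where "w' = (\<chi> r c. f (\<tau> r) $ r $ c)"
  \<comment> \<open>Dividing row \<open>r\<close> by the unit \<open>d r\<close> turns the diagonal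
    product \<open>w' ** w\<close> into the identity and stays within the order.\<close>
  define v where "v = monomial_matrix (\<lambda>r. inverse (d r)) id ** w'"
  have w_in: "w \<in> \<Lambda>" and w'_in: "w' \<in> \<Lambda>"
    using f by (simp_all add: order_iff w_def w'_def)
  have v_in: "v \<in> \<Lambda>"
    using w'_in d unfolding order_iff
    by (simp add: v_def monomial_matrix_mult_nth unit_group_def
        del: times_divide_eq_right add: times_divide_eq_right[symmetric])
  have "(w' ** w) $ r $ c = (f (\<tau> r) ** f (\<tau> c)) $ r $ c" for r c
    by (simp add: matrix_matrix_mult_def w_def w'_def)
  moreover have "\<tau> r = \<tau> c \<longleftrightarrow> r = c" for r c
    using \<sigma>\<tau> by metis
  ultimately have w'w: "(w' ** w) $ r $ c = (if r = c then d r else 0)" for r c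
    by (simp add: ff d_def)
  have vw: "v ** w = mat 1"
    using d by (simp add: vec_eq_iff v_def monomial_matrix_mult_nth w'w mat_def unit_group_def
        flip: matrix_mul_assoc)
  then have wv: "w ** v = mat 1"
    by (simp add: matrix_left_right_inverse)
  have w: "w \<in> Units (tiled_ring R \<pi> \<alpha>)"
    using vw wv w_in v_in by (auto simp: Units_iff)
  have "conj_by \<Lambda> w (f i) = matrix_unit (\<sigma> i) (\<sigma> i) 1" for i
  proof -
    have "(f i ** w) $ r $ c = (f i ** f (\<tau> c)) $ r $ c" for r c
      by (simp add: matrix_matrix_mult_def w_def)
    \<comment> \<open>By orthogonality both sides keep column \<open>\<sigma> i\<close> of
      \<open>w\<close> and kill all other columns.\<close>
    then have "f i ** w = w ** matrix_unit (\<sigma> i) (\<sigma> i) 1"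
      by (auto simp: vec_eq_iff ff matrix_unit_mult_right_nth w_def \<sigma>\<tau>)
    then have "v ** f i ** w = (v ** w) ** matrix_unit (\<sigma> i) (\<sigma> i) 1"
      by (simp flip: matrix_mul_assoc)
    then show ?thesis
      using conj_by_apply[OF vw f] vw by simp
  qed
  then show thesis
    using that w by (simp add: \<sigma>_def f_def)
qed

text \<open>Multiplying by idempotents on both sides isolates one entry, so \<open>\<phi>\<close>
  acts entry by entry; linearity over \<open>R\<close> makes this action a scaling, and
  multiplicativity makes the factors a cocycle.\<close>

lemma monomial_of_permuting_idempotents:
  assumes \<phi>: "\<phi> \<in> carrier Aut" and \<sigma>: "\<sigma> permutes UNIV"
    and idem: "\<And>i. \<phi> (matrix_unit i i 1) = matrix_unit (\<sigma> i) (\<sigma> i) 1"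
  obtains t where "\<And>i. t i \<noteq> 0" "\<phi> = conj_by \<Lambda> (monomial_matrix t \<sigma>)"
proof -
  define E where "E i j = (matrix_unit i j (\<pi> ^ \<alpha> i j) :: 'k^'n^'n)" for i j
  define c where "c i j = \<phi> (E i j) $ \<sigma> i $ \<sigma> j" for i j
  \<comment> \<open>\<open>c i j\<close> is the image of the generator
    \<open>\<pi> ^ \<alpha> i j\<close> of the corner; the quotient is the scaling factor for
    arbitrary entries.\<close>
  define b where "b i j = c i j / \<pi> ^ \<alpha> i j" for i j
  have E: "E i j \<in> \<Lambda>" for i j
    using uniformizer_nonzero by (simp add: E_def order_matrix_unit)
  have corner: "\<phi> (matrix_unit i j (A $ i $ j)) = matrix_unit (\<sigma> i) (\<sigma> j) (\<phi> A $ \<sigma> i $ \<sigma> j)"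
    if "A \<in> \<Lambda>" for A i j
  proof -
    have "\<phi> (matrix_unit i j (A $ i $ j)) = \<phi> (matrix_unit i i 1 ** A ** matrix_unit j j 1)"
      by (simp add: matrix_unit_sandwich)
    also have "\<dots> = matrix_unit (\<sigma> i) (\<sigma> i) 1 ** \<phi> A ** matrix_unit (\<sigma> j) (\<sigma> j) 1"
      using that \<phi> by (simp add: Aut_mult order_mult order_idempotent idem)
    also have "\<dots> = matrix_unit (\<sigma> i) (\<sigma> j) (\<phi> A $ \<sigma> i $ \<sigma> j)"
      by (simp add: matrix_unit_sandwich)
    finally show ?thesis .
  qed
  have \<phi>E: "\<phi> (E i j) = matrix_unit (\<sigma> i) (\<sigma> j) (c i j)" for i j
    using corner[OF E, of i j i j] by (simp add: c_def E_def matrix_unit_nth)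
  have entry: "\<phi> A $ \<sigma> i $ \<sigma> j = A $ i $ j * b i j" if "A \<in> \<Lambda>" for A i j
  proof -
    let ?s = "A $ i $ j / \<pi> ^ \<alpha> i j"
    have s: "?s \<in> R" using that by (simp add: order_iff)
    have "matrix_unit i j (A $ i $ j) = mat ?s ** E i j"
      using uniformizer_nonzero by (simp add: vec_eq_iff mat_mult_nth E_def matrix_unit_nth)
    then have "matrix_unit (\<sigma> i) (\<sigma> j) (\<phi> A $ \<sigma> i $ \<sigma> j)
        = mat ?s ** matrix_unit (\<sigma> i) (\<sigma> j) (c i j)"
      using corner[OF that, of i j] Aut_scalar[OF \<phi> s E] by (simp add: \<phi>E)
    then have "matrix_unit (\<sigma> i) (\<sigma> j) (\<phi> A $ \<sigma> i $ \<sigma> j) $ \<sigma> i $ \<sigma> j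
        = (mat ?s ** matrix_unit (\<sigma> i) (\<sigma> j) (c i j)) $ \<sigma> i $ \<sigma> j"
      by simp
    then show ?thesis
      by (simp add: matrix_unit_nth mat_mult_nth b_def)
  qed
  have b0: "b i j \<noteq> 0" for i j
  proof
    assume "b i j = 0"
    then have "\<phi> (E i j) = 0"
      using uniformizer_nonzero by (simp add: \<phi>E b_def vec_eq_iff matrix_unit_nth)
    then have "E i j = 0"
      using inj_onD[OF Aut_inj[OF \<phi>], of "E i j" 0] E order_zero Aut_zero[OF \<phi>] by simp
    then have "E i j $ i $ j = 0" by simp
    then show False
      using uniformizer_nonzero by (simp add: E_def matrix_unit_nth)
  qed
  have cocycle: "b i j * b j k = b i k" for i j k
  proof -
    have prod: "E i j ** E j k = matrix_unit i k (\<pi> ^ \<alpha> i j * \<pi> ^ \<alpha> j k)"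
      by (simp add: E_def matrix_unit_mult)
    have "c i j * c j k = \<phi> (E i j ** E j k) $ \<sigma> i $ \<sigma> k"
      by (simp add: Aut_mult[OF \<phi> E E] \<phi>E matrix_unit_mult matrix_unit_nth)
    also have "\<dots> = \<pi> ^ \<alpha> i j * \<pi> ^ \<alpha> j k * b i k"
      using entry[OF order_mult[OF E E], of i j j k i k] by (simp add: prod matrix_unit_nth)
    finally show ?thesis
      using uniformizer_nonzero by (simp add: b_def field_simps)
  qed
  \<comment> \<open>Any index can serve as base point; the row of \<open>b\<close> at
    \<open>i0\<close> writes the cocycle as a coboundary.\<close>
  obtain i0 :: 'n where True by simp
  define t where "t i = b i0 i" for i
  have t0: "t i \<noteq> 0" for i by (simp add: t_def b0)
  have bt: "b i j = t j / t i" for i j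
    using cocycle[of i0 i j] b0[of i0 i] by (simp add: t_def field_simps)
  have "\<phi> = conj_by \<Lambda> (monomial_matrix t \<sigma>)"
  proof (rule extensionalityI[where A = \<Lambda>])
    fix A assume A: "A \<in> \<Lambda>"
    have "\<phi> A $ \<sigma> i $ \<sigma> j = conj_by \<Lambda> (monomial_matrix t \<sigma>) A $ \<sigma> i $ \<sigma> j" for i j
      using conj_by_monomial_nth[OF \<sigma> t0 A] entry[OF A] by (simp add: bt)
    then show "\<phi> A = conj_by \<Lambda> (monomial_matrix t \<sigma>) A"
      unfolding vec_eq_iff using permutes_inverses(1)[OF \<sigma>] by metis
  qed (use \<phi> in \<open>simp_all add: Aut_extensional conj_by_extensional\<close>)
  then show thesis using that t0 by blast
qed

text \<open>Once the idempotents are straightened, only a diagonal matrix of units separates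
  \<open>\<phi>\<close> from a conjugation by powers of \<open>\<pi>\<close> and a permutation. Both
  corrections are inner and are collected in \<open>\<nu>\<close>.\<close>

lemma Aut_factorization:
  assumes \<phi>: "\<phi> \<in> carrier Aut"
  obtains \<nu> x where "\<nu> \<in> Inn R \<pi> \<alpha>" "solves_full_system \<alpha> (Phi R \<pi> \<alpha> \<phi>) x"
    "\<phi> = \<nu> \<otimes>\<^bsub>Aut\<^esub> conj_by \<Lambda> (diag_pow \<pi> x ** perm_matrix (Phi R \<pi> \<alpha> \<phi>))"
proof -
  let ?\<sigma> = "Phi R \<pi> \<alpha> \<phi>"
  note \<sigma> = Phi_permutes[OF \<phi>]
  obtain w where w: "w \<in> Units (tiled_ring R \<pi> \<alpha>)"
    and straight: "\<And>i. conj_by \<Lambda> w (\<phi> (matrix_unit i i 1)) = matrix_unit (?\<sigma> i) (?\<sigma> i) 1"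
    using straighten_idempotents[OF \<phi>] by blast
  have \<omega>: "conj_by \<Lambda> w \<in> carrier Aut" "conj_by \<Lambda> w \<in> Inn R \<pi> \<alpha>"
    using w by (simp_all add: conj_by_unit_in_Aut Inn_def)
  define \<psi> where "\<psi> = conj_by \<Lambda> w \<otimes>\<^bsub>Aut\<^esub> \<phi>"
  have \<psi>: "\<psi> \<in> carrier Aut"
    using \<phi> \<omega> by (simp add: \<psi>_def)
  have "\<psi> (matrix_unit i i 1) = matrix_unit (?\<sigma> i) (?\<sigma> i) 1" for i
    using \<phi> \<omega> straight by (simp add: \<psi>_def Aut_mult_apply order_idempotent)
  then obtain t where t: "\<And>i. t i \<noteq> 0" and \<psi>_eq: "\<psi> = conj_by \<Lambda> (monomial_matrix t ?\<sigma>)"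
    using monomial_of_permuting_idempotents[OF \<psi> \<sigma>] by blast
  have "\<exists>u m. u \<in> unit_group \<and> t i = u * \<pi> powi m" for i
    using exists_uniformizer_power[OF t] by metis
  then obtain \<eta> x where \<eta>: "\<And>i. \<eta> i \<in> unit_group" and t_eq: "\<And>i. t i = \<eta> i * \<pi> powi x i"
    by metis
  have x: "solves_full_system \<alpha> ?\<sigma> x"
    by (rule solves_full_system_of_monomial_conj[where \<eta> = \<eta>, OF \<sigma>])
      (use \<eta> \<psi> in \<open>simp_all add: \<psi>_eq flip: t_eq\<close>)
  define X where "X = (diag_pow \<pi> x ** perm_matrix ?\<sigma> :: 'k^'n^'n)"
  \<comment> \<open>Relabelling by the inverse permutation moves the diagonal of units to the right
    of the permutation matrix. As conjugation reverses products, its inner automorphism then becomes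
    the left factor.\<close>
  define \<eta>' where "\<eta>' i = \<eta> (inv_into UNIV ?\<sigma> i)" for i
  have \<eta>': "\<eta>' i \<in> unit_group" "\<eta>' (?\<sigma> i) = \<eta> i" for i
    using \<eta> permutes_inverses(2)[OF \<sigma>] by (simp_all add: \<eta>'_def)
  have D_in: "monomial_matrix \<delta> id \<in> \<Lambda>" if "\<And>i. \<delta> i \<in> R" for \<delta>
    using that by (simp add: order_iff monomial_matrix_def)
  have D_mult: "monomial_matrix s id ** monomial_matrix t id = (mat 1 :: 'k^'n^'n)"
    if "\<And>i. s i * t i = 1" for s t
    using that by (simp add: monomial_matrix_mult monomial_matrix_id)
  have D_inv: "monomial_matrix (\<lambda>i. inverse (\<eta>' i)) id ** monomial_matrix \<eta>' id = (mat 1 :: 'k^'n^'n)"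
    "monomial_matrix \<eta>' id ** monomial_matrix (\<lambda>i. inverse (\<eta>' i)) id = (mat 1 :: 'k^'n^'n)"
    using \<eta>'(1) by (auto intro!: D_mult simp: unit_group_def)
  then have D: "monomial_matrix \<eta>' id \<in> Units (tiled_ring R \<pi> \<alpha>)"
    using \<eta>'(1) by (auto simp: Units_iff unit_group_def
        intro!: D_in bexI[of _ "monomial_matrix (\<lambda>i. inverse (\<eta>' i)) id"])
  have t_fun: "t = (\<lambda>i. \<pi> powi x i * \<eta>' (?\<sigma> i))"
    by (simp add: fun_eq_iff t_eq \<eta>'(2) mult.commute)
  have "monomial_matrix t ?\<sigma> = X ** monomial_matrix \<eta>' id"
    by (simp add: X_def diag_pow_mult_perm_matrix monomial_matrix_mult t_fun)
  moreover have X: "conj_by \<Lambda> X \<in> carrier Aut"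
    using x by (simp add: X_def diag_perm_conj_in_Aut_iff[OF \<sigma>])
  moreover have "monomial_inverse (\<lambda>i. \<pi> powi x i) ?\<sigma> ** X = mat 1"
    unfolding X_def diag_pow_mult_perm_matrix
    using uniformizer_nonzero by (intro monomial_matrix_mult_inverse(2)[OF \<sigma>]) simp
  ultimately have "\<psi> = conj_by \<Lambda> (monomial_matrix \<eta>' id) \<otimes>\<^bsub>Aut\<^esub> conj_by \<Lambda> X"
    using \<psi>_eq conj_by_mult[OF D_inv(1)] conj_by_unit_in_Aut[OF D] by simp
  moreover have "\<phi> = inv\<^bsub>Aut\<^esub> (conj_by \<Lambda> w) \<otimes>\<^bsub>Aut\<^esub> \<psi>"
    using \<phi> \<omega> by (simp add: \<psi>_def Aut.m_assoc[symmetric])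
  ultimately have "\<phi> = (inv\<^bsub>Aut\<^esub> (conj_by \<Lambda> w) \<otimes>\<^bsub>Aut\<^esub> conj_by \<Lambda> (monomial_matrix \<eta>' id)) \<otimes>\<^bsub>Aut\<^esub> conj_by \<Lambda> X"
    using \<omega> X conj_by_unit_in_Aut[OF D] by (simp add: Aut.m_assoc)
  moreover have "inv\<^bsub>Aut\<^esub> (conj_by \<Lambda> w) \<otimes>\<^bsub>Aut\<^esub> conj_by \<Lambda> (monomial_matrix \<eta>' id) \<in> Inn R \<pi> \<alpha>"
    using \<omega> D by (intro subgroup.m_closed[OF Inn_subgroup] subgroup.m_inv_closed[OF Inn_subgroup])
      (simp_all add: Inn_def)
  ultimately show thesis
    using that x unfolding X_def by blast
qed

lemma solves_full_system_imp_liftable: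
  assumes "\<sigma> permutes UNIV" "solves_full_system \<alpha> \<sigma> x"
  shows "liftable R \<pi> \<alpha> \<sigma>"
  using Phi_liftable diag_perm_conj_in_Aut_iff[OF assms(1)] Phi_diag_perm_conj[OF assms] assms(2)
  by metis

text \<open>A full solution yields an automorphism inducing \<open>\<sigma>\<close>, and every
  induced permutation respects the link graph. Conversely, the factorization of a lift provides a
  solution.\<close>

lemma liftable_iff:
  "liftable R \<pi> \<alpha> \<sigma> \<longleftrightarrow> \<sigma> permutes UNIV \<and> (\<exists>x. solves_full_system \<alpha> \<sigma> x)"
proof
  assume "liftable R \<pi> \<alpha> \<sigma>"
  then obtain \<phi> where "\<phi> \<in> carrier Aut" "\<sigma> = Phi R \<pi> \<alpha> \<phi>"
    by (auto simp: liftable_def)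
  then show "\<sigma> permutes UNIV \<and> (\<exists>x. solves_full_system \<alpha> \<sigma> x)"
    using Aut_factorization Phi_permutes by metis
qed (auto intro: solves_full_system_imp_liftable)

text \<open>This is \<open>O_Lambda\<close> expressed by the full system, which makes sense for
  unordered indices and already carries liftability. Admitting all solutions is harmless: for fixed
  \<open>\<sigma>\<close> they differ by constants, which do not change the conjugation.\<close>

definition monomial_automorphisms :: "('k^'n^'n \<Rightarrow> 'k^'n^'n) set" where
  "monomial_automorphisms =
     {conj_by \<Lambda> (diag_pow \<pi> x ** perm_matrix \<sigma>) | x \<sigma>.
        \<sigma> permutes UNIV \<and> solves_full_system \<alpha> \<sigma> x}"

text \<open>Conjugation reverses the two matrices, and multiplying permutation matrices reverses
  composition; the reversals cancel, which leaves \<open>\<sigma> \<circ> \<tau>\<close>.\<close>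

lemma diag_perm_conj_mult:
  assumes "\<sigma> permutes UNIV" "solves_full_system \<alpha> \<sigma> x"
    and "\<tau> permutes UNIV" "solves_full_system \<alpha> \<tau> y"
  shows "conj_by \<Lambda> (diag_pow \<pi> x ** perm_matrix \<sigma>) \<otimes>\<^bsub>Aut\<^esub> conj_by \<Lambda> (diag_pow \<pi> y ** perm_matrix \<tau>)
    = conj_by \<Lambda> (diag_pow \<pi> (\<lambda>i. y i + x (\<tau> i)) ** perm_matrix (\<sigma> \<circ> \<tau>))"
proof -
  have "conj_by \<Lambda> (diag_pow \<pi> x ** perm_matrix \<sigma>) \<otimes>\<^bsub>Aut\<^esub> conj_by \<Lambda> (diag_pow \<pi> y ** perm_matrix \<tau>)
    = conj_by \<Lambda> ((diag_pow \<pi> y ** perm_matrix \<tau>) ** (diag_pow \<pi> x ** perm_matrix \<sigma>))"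
  proof (rule conj_by_mult)
    show "monomial_inverse (\<lambda>i. \<pi> powi x i) \<sigma> ** (diag_pow \<pi> x ** perm_matrix \<sigma>) = mat 1"
      "monomial_inverse (\<lambda>i. \<pi> powi y i) \<tau> ** (diag_pow \<pi> y ** perm_matrix \<tau>) = mat 1"
      unfolding diag_pow_mult_perm_matrix
      using assms uniformizer_nonzero by (auto intro!: monomial_matrix_mult_inverse(2))
  qed (use assms in \<open>simp_all add: diag_perm_conj_in_Aut_iff\<close>)
  then show ?thesis
    using uniformizer_nonzero
    by (simp add: diag_pow_mult_perm_matrix monomial_matrix_mult power_int_add)
qed

text \<open>For the identity permutation every solution is constant, so the matrix is
  scalar.\<close>

lemma diag_perm_conj_id:
  assumes "solves_full_system \<alpha> id x"
  shows "conj_by \<Lambda> (diag_pow \<pi> x ** perm_matrix id) = \<one>\<^bsub>Aut\<^esub>"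
proof (rule extensionalityI[where A = \<Lambda>])
  fix A assume A: "A \<in> \<Lambda>"
  have "x i = x j" for i j
    using assms[unfolded solves_full_system_def, rule_format, of i j] by simp
  then have ratio: "\<pi> powi x j / \<pi> powi x i = 1" for i j
    using uniformizer_nonzero by (metis divide_self power_int_not_zero)
  have "conj_by \<Lambda> (monomial_matrix (\<lambda>i. \<pi> powi x i) id) A $ id i $ id j
      = A $ i $ j * (\<pi> powi x j / \<pi> powi x i)" for i j
    by (rule conj_by_monomial_nth) (simp_all add: A permutes_id uniformizer_nonzero)
  then have "conj_by \<Lambda> (monomial_matrix (\<lambda>i. \<pi> powi x i) id) A $ id i $ id j = A $ i $ j" for i j
    by (simp only: ratio mult_1_right)
  then show "conj_by \<Lambda> (diag_pow \<pi> x ** perm_matrix id) A = \<one>\<^bsub>Aut\<^esub> A"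
    using A by (simp add: vec_eq_iff diag_pow_mult_perm_matrix Aut_one_eq)
qed (simp_all add: conj_by_extensional Aut_one_eq)

lemma monomial_automorphisms_subgroup: "subgroup monomial_automorphisms Aut"
proof (rule Aut.subgroupI)
  show "monomial_automorphisms \<subseteq> carrier Aut"
    by (auto simp: monomial_automorphisms_def diag_perm_conj_in_Aut_iff)
  have "solves_full_system \<alpha> id (\<lambda>_. 0)"
    by (simp add: solves_full_system_def)
  then show "monomial_automorphisms \<noteq> {}"
    unfolding monomial_automorphisms_def using permutes_id by blast
next
  fix \<phi> \<psi> assume "\<phi> \<in> monomial_automorphisms" "\<psi> \<in> monomial_automorphisms"
  then obtain x \<sigma> y \<tau> where *: "\<sigma> permutes UNIV" "solves_full_system \<alpha> \<sigma> x"
    "\<phi> = conj_by \<Lambda> (diag_pow \<pi> x ** perm_matrix \<sigma>)"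
    "\<tau> permutes UNIV" "solves_full_system \<alpha> \<tau> y"
    "\<psi> = conj_by \<Lambda> (diag_pow \<pi> y ** perm_matrix \<tau>)"
    by (auto simp: monomial_automorphisms_def)
  have "solves_full_system \<alpha> (\<sigma> \<circ> \<tau>) (\<lambda>i. y i + x (\<tau> i))"
    unfolding solves_full_system_def
  proof (intro allI)
    fix i j
    show "y i + x (\<tau> i) - (y j + x (\<tau> j)) = int (\<alpha> i j) - int (\<alpha> ((\<sigma> \<circ> \<tau>) i) ((\<sigma> \<circ> \<tau>) j))"
      using *(5)[unfolded solves_full_system_def, rule_format, of i j]
        *(2)[unfolded solves_full_system_def, rule_format, of "\<tau> i" "\<tau> j"] by simp
  qed
  then show "\<phi> \<otimes>\<^bsub>Aut\<^esub> \<psi> \<in> monomial_automorphisms"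
    using * permutes_compose[of \<tau> UNIV \<sigma>] by (auto simp: monomial_automorphisms_def diag_perm_conj_mult)
next
  fix \<phi> assume "\<phi> \<in> monomial_automorphisms"
  then obtain x \<sigma> where *: "\<sigma> permutes UNIV" "solves_full_system \<alpha> \<sigma> x"
    "\<phi> = conj_by \<Lambda> (diag_pow \<pi> x ** perm_matrix \<sigma>)"
    by (auto simp: monomial_automorphisms_def)
  define \<tau> where "\<tau> = inv_into UNIV \<sigma>"
  have \<tau>: "\<tau> permutes UNIV" "\<And>i. \<sigma> (\<tau> i) = i" "\<tau> \<circ> \<sigma> = id" "\<sigma> \<circ> \<tau> = id"
    using permutes_inv[OF *(1)] permutes_inverses[OF *(1)] permutes_inv_o[OF *(1)]
    by (simp_all add: \<tau>_def)
  \<comment> \<open>These are the exponents of the inverse matrix: moving the inverse diagonal to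
    the left of the permutation matrix of \<open>\<tau>\<close> reindexes \<open>- x\<close> by
    \<open>\<tau>\<close>.\<close>
  have y: "solves_full_system \<alpha> \<tau> (\<lambda>i. - x (\<tau> i))"
    unfolding solves_full_system_def
  proof (intro allI)
    fix i j
    show "- x (\<tau> i) - - x (\<tau> j) = int (\<alpha> i j) - int (\<alpha> (\<tau> i) (\<tau> j))"
      using *(2)[unfolded solves_full_system_def, rule_format, of "\<tau> i" "\<tau> j"] \<tau>(2) by simp
  qed
  define \<psi> where "\<psi> = conj_by \<Lambda> (diag_pow \<pi> (\<lambda>i. - x (\<tau> i)) ** perm_matrix \<tau>)"
  have "\<phi> \<otimes>\<^bsub>Aut\<^esub> \<psi> = conj_by \<Lambda> (diag_pow \<pi> (\<lambda>i. 0) ** perm_matrix id)"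
    unfolding *(3) \<psi>_def using diag_perm_conj_mult[OF *(1,2) \<tau>(1) y] \<tau>(4) by simp
  also have "\<dots> = \<one>\<^bsub>Aut\<^esub>"
    by (rule diag_perm_conj_id) (simp add: solves_full_system_def)
  finally have "inv\<^bsub>Aut\<^esub> \<psi> = \<phi>"
    using * \<tau>(1) y by (intro Aut.inv_equality) (simp_all add: \<psi>_def diag_perm_conj_in_Aut_iff)
  then have "inv\<^bsub>Aut\<^esub> \<phi> = \<psi>"
    using \<tau>(1) y by (auto simp: \<psi>_def diag_perm_conj_in_Aut_iff)
  then show "inv\<^bsub>Aut\<^esub> \<phi> \<in> monomial_automorphisms"
    using \<tau>(1) y by (auto simp: monomial_automorphisms_def \<psi>_def)
qed

text \<open>Inner automorphisms induce the identity permutation, so \<open>\<sigma> = id\<close>,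
  and then the conjugation is trivial.\<close>

lemma Inn_inter_monomial: "Inn R \<pi> \<alpha> \<inter> monomial_automorphisms = {\<one>\<^bsub>Aut\<^esub>}"
proof (intro equalityI subsetI)
  fix \<phi> assume "\<phi> \<in> Inn R \<pi> \<alpha> \<inter> monomial_automorphisms"
  then obtain x \<sigma> where *: "\<phi> \<in> Inn R \<pi> \<alpha>" "\<sigma> permutes UNIV" "solves_full_system \<alpha> \<sigma> x"
    "\<phi> = conj_by \<Lambda> (diag_pow \<pi> x ** perm_matrix \<sigma>)"
    by (auto simp: monomial_automorphisms_def)
  then have "\<sigma> = id"
    using Phi_Inn Phi_diag_perm_conj by metis
  then show "\<phi> \<in> {\<one>\<^bsub>Aut\<^esub>}"
    using * diag_perm_conj_id by simp
qed (use subgroup.one_closed[OF Inn_subgroup] subgroup.one_closed[OF monomial_automorphisms_subgroup] in auto)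

lemma Aut_semidirect: "internal_semidirect Aut (Inn R \<pi> \<alpha>) monomial_automorphisms"
proof -
  have "Inn R \<pi> \<alpha> <#>\<^bsub>Aut\<^esub> monomial_automorphisms = carrier Aut"
  proof
    show "Inn R \<pi> \<alpha> <#>\<^bsub>Aut\<^esub> monomial_automorphisms \<subseteq> carrier Aut"
      by (intro Aut.set_mult_closed subgroup.subset Inn_subgroup monomial_automorphisms_subgroup)
    show "carrier Aut \<subseteq> Inn R \<pi> \<alpha> <#>\<^bsub>Aut\<^esub> monomial_automorphisms"
    proof
      fix \<phi> assume \<phi>: "\<phi> \<in> carrier Aut"
      obtain \<nu> x where "\<nu> \<in> Inn R \<pi> \<alpha>" "solves_full_system \<alpha> (Phi R \<pi> \<alpha> \<phi>) x"
        and eq: "\<phi> = \<nu> \<otimes>\<^bsub>Aut\<^esub> conj_by \<Lambda> (diag_pow \<pi> x ** perm_matrix (Phi R \<pi> \<alpha> \<phi>))"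
        using Aut_factorization[OF \<phi>] .
      moreover have "conj_by \<Lambda> (diag_pow \<pi> x ** perm_matrix (Phi R \<pi> \<alpha> \<phi>)) \<in> monomial_automorphisms"
        using Phi_permutes[OF \<phi>] calculation by (auto simp: monomial_automorphisms_def)
      ultimately show "\<phi> \<in> Inn R \<pi> \<alpha> <#>\<^bsub>Aut\<^esub> monomial_automorphisms"
        unfolding set_mult_def by blast
    qed
  qed
  then show ?thesis
    by (simp add: internal_semidirect_def Inn_normal monomial_automorphisms_subgroup Inn_inter_monomial)
qed

text \<open>Composing with conjugation by the inverse of \<open>u\<close> strips off the unit and
  leaves a monomial conjugation.\<close>

lemma solves_full_system_of_conj_in_Aut:
  assumes u: "u \<in> Units (tiled_ring R \<pi> \<alpha>)" and \<sigma>: "\<sigma> permutes UNIV"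
    and \<phi>: "conj_by \<Lambda> (u ** diag_pow \<pi> d ** perm_matrix \<sigma>) \<in> carrier Aut"
  shows "solves_full_system \<alpha> \<sigma> d"
proof -
  let ?X = "diag_pow \<pi> d ** perm_matrix \<sigma> :: 'k^'n^'n"
  let ?Y = "monomial_inverse (\<lambda>i. \<pi> powi d i) \<sigma>"
  obtain v where v: "v \<in> \<Lambda>" "v ** u = mat 1" "u ** v = mat 1"
    using u by (auto simp: Units_iff)
  then have v_unit: "v \<in> Units (tiled_ring R \<pi> \<alpha>)"
    using u by (auto simp: Units_iff)
  have YX: "?Y ** ?X = mat 1"
    unfolding diag_pow_mult_perm_matrix
    using uniformizer_nonzero by (intro monomial_matrix_mult_inverse(2)[OF \<sigma>]) simp
  have "(?Y ** v) ** (u ** ?X) = ?Y ** (v ** u) ** ?X"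
    by (simp flip: matrix_mul_assoc)
  then have "(?Y ** v) ** (u ** ?X) = mat 1"
    using v YX by simp
  then have "conj_by \<Lambda> (u ** ?X) \<otimes>\<^bsub>Aut\<^esub> conj_by \<Lambda> v = conj_by \<Lambda> (v ** (u ** ?X))"
    using v \<phi> conj_by_unit_in_Aut[OF v_unit] by (intro conj_by_mult) (simp_all add: matrix_mul_assoc)
  moreover have "v ** (u ** ?X) = ?X"
    using v by (simp add: matrix_mul_assoc)
  moreover have "conj_by \<Lambda> (u ** ?X) \<otimes>\<^bsub>Aut\<^esub> conj_by \<Lambda> v \<in> carrier Aut"
    using \<phi> conj_by_unit_in_Aut[OF v_unit] by (intro Aut.m_closed) (simp_all add: matrix_mul_assoc)
  ultimately show ?thesis
    using diag_perm_conj_in_Aut_iff[OF \<sigma>] by simp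
qed

end

text \<open>For \<open>i < j\<close> both systems prescribe the same difference, so \<open>x\<close>
  and \<open>y\<close> have equal differences there, hence by antisymmetry everywhere;
  \<open>y\<close> then supplies the remaining equations.\<close>

lemma solves_full_system_of_solves_system:
  assumes "solves_full_system \<alpha> \<sigma> y" "solves_system \<alpha> \<sigma> x"
  shows "solves_full_system \<alpha> \<sigma> x"
proof -
  have "x i - x j = y i - y j" if "i < j" for i j
    using that assms by (simp add: solves_full_system_def solves_system_def)
  then have "x i - x j = y i - y j" for i j
    by (metis diff_eq_diff_eq diff_self linorder_neqE minus_diff_eq)
  then show ?thesis
    using assms(1) by (simp add: solves_full_system_def)
qed

text \<open>Solvability is asked of the full system, since the equations for \<open>i < j\<close>
  alone do not imply liftability. Once \<open>\<sigma>\<close> is liftable both systems have the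
  same solutions, so the conjugations may be described by the smaller one.\<close>

theorem theorem5:
  fixes R :: "'k::field set" and \<pi> :: 'k
    and \<alpha> :: "'n::{finite,linorder} \<Rightarrow> 'n \<Rightarrow> nat"
  assumes "complete_dvr R \<pi>"
    and "exponent_matrix \<alpha>"
    and "standard_max_ideals R \<pi> \<alpha>"
  shows
    "(\<forall>\<sigma> \<in> graph_automorphisms (link_graph R \<pi> \<alpha>).
        liftable R \<pi> \<alpha> \<sigma> \<longleftrightarrow> (\<exists>x. solves_full_system \<alpha> \<sigma> x)) \<and>
     (\<forall>\<sigma> x. liftable R \<pi> \<alpha> \<sigma> \<and> solves_system \<alpha> \<sigma> x \<longrightarrow>
        conj_by (tiled_order R \<pi> \<alpha>) (diag_pow \<pi> x ** perm_matrix \<sigma>) \<in> carrier (AutR R \<pi> \<alpha>)) \<and>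
     (\<forall>\<phi> \<in> carrier (AutR R \<pi> \<alpha>). \<forall>u \<in> Units (tiled_ring R \<pi> \<alpha>). \<forall>d \<sigma>.
        \<sigma> permutes UNIV \<and>
        \<phi> = conj_by (tiled_order R \<pi> \<alpha>) (u ** diag_pow \<pi> d ** perm_matrix \<sigma>) \<longrightarrow>
        solves_full_system \<alpha> \<sigma> d) \<and>
     subgroup (O_Lambda R \<pi> \<alpha>) (AutR R \<pi> \<alpha>) \<and>
     internal_semidirect (AutR R \<pi> \<alpha>) (Inn R \<pi> \<alpha>) (O_Lambda R \<pi> \<alpha>)"
proof -
  interpret standard_tiled_order R \<pi> \<alpha>
    using assms unfolding complete_dvr_def
    by (intro standard_tiled_order.intro dvr_in_field.intro standard_tiled_order_axioms.intro) simp_all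
  \<comment> \<open>This identifies \<open>O_Lambda\<close> with
    \<open>monomial_automorphisms\<close>: liftability supplies the full solution with which
    \<open>x\<close> is compared.\<close>
  have system_iff: "liftable R \<pi> \<alpha> \<sigma> \<and> solves_system \<alpha> \<sigma> x \<longleftrightarrow>
      \<sigma> permutes UNIV \<and> solves_full_system \<alpha> \<sigma> x" for \<sigma> x
  proof
    assume "liftable R \<pi> \<alpha> \<sigma> \<and> solves_system \<alpha> \<sigma> x"
    then show "\<sigma> permutes UNIV \<and> solves_full_system \<alpha> \<sigma> x"
      using solves_full_system_of_solves_system unfolding liftable_iff by blast
  next
    assume *: "\<sigma> permutes UNIV \<and> solves_full_system \<alpha> \<sigma> x"
    then have "solves_system \<alpha> \<sigma> x"
      unfolding solves_full_system_def solves_system_def by blast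
    then show "liftable R \<pi> \<alpha> \<sigma> \<and> solves_system \<alpha> \<sigma> x"
      using * unfolding liftable_iff by blast
  qed
  have "O_Lambda R \<pi> \<alpha> = monomial_automorphisms"
    unfolding O_Lambda_def monomial_automorphisms_def system_iff ..
  moreover have "liftable R \<pi> \<alpha> \<sigma> \<longleftrightarrow> (\<exists>x. solves_full_system \<alpha> \<sigma> x)"
    if "\<sigma> \<in> graph_automorphisms (link_graph R \<pi> \<alpha>)" for \<sigma>
    using that unfolding liftable_iff by (simp add: graph_automorphisms_def)
  moreover have "conj_by \<Lambda> (diag_pow \<pi> x ** perm_matrix \<sigma>) \<in> carrier Aut"
    if "liftable R \<pi> \<alpha> \<sigma> \<and> solves_system \<alpha> \<sigma> x" for \<sigma> x
    using that unfolding system_iff by (simp add: diag_perm_conj_in_Aut_iff)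
  ultimately show ?thesis
    using Aut_semidirect monomial_automorphisms_subgroup solves_full_system_of_conj_in_Aut
    by (intro conjI ballI allI impI) auto
qed

end
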